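(* Suppose that $\varphi$ is an analytic self-map of the unit disk $D$, $u\in H(D)$, $0<p<\infty$, that $\phi$ is normal on $[0,1)$, and that the weighted composition operator $uC_\varphi : H(p,p,\phi)\to\mathcal{B}$ is bounded. Then $uC_\varphi : H(p,p,\phi)\to\mathcal{B}$ is compact if and only if both of the following conditions are satisfied: (i) $$\lim_{|\varphi(z)|\to1}\frac{(1-|z|^2)|u'(z)|}{\phi(|\varphi(z)|)(1-|\varphi(z)|^2)^{1/p}}=0;$$ (ii) $$\lim_{|\varphi(z)|\to1}\frac{(1-|z|^2)|u(z)\varphi'(z)|}{\phi(|\varphi(z)|)(1-|\varphi(z)|^2)^{1+1/p}}=0.$$
   Context: $D$ is the open unit disk in $\mathbb{C}$ and $H(D)$ is the class of all analytic functions on $D$. An analytic self-map of $D$ is an analytic function $\varphi:D\to D$. For $u\in H(D)$, the weighted composition operator is $uC_\varphi f=u\cdot(f\circ\varphi)$, $f\in H(D)$. A positive continuous function $\phi$ on $[0,1)$ is called normal if there exist $s,t$ with $0<s<t$ such that $\frac{\phi(r)}{(1-r)^s}\downarrow 0$ and $\frac{\phi(r)}{(1-r)^t}\uparrow\infty$ as $r\to1^-$. For $0<p<\infty$ and normal $\phi$, $H(p,p,\phi)$ is the space of all $f\in H(D)$ such that $\|f\|_{H(p,p,\phi)}=\left(\int_0^1 M_p^p(f,r)\frac{\phi^p(r)}{1-r}\,r\,dr\right)^{1/p}<\infty$, where $M_p(f,r)=\left(\frac1{2\pi}\int_0^{2\pi}|f(re^{i\theta})|^p\,d\theta\right)^{1/p}$,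 $0\le r<1$ (a norm for $p\ge1$, a quasinorm for $0<p<1$). The Bloch space $\mathcal{B}$ is the space of $f\in H(D)$ with $B(f)=\sup_{z\in D}(1-|z|^2)|f'(z)|<\infty$, normed by $\|f\|_{\mathcal{B}}=|f(0)|+B(f)$. A linear operator is bounded if it maps the first space into the second and the image of every bounded set is bounded; it is compact if it takes bounded sets to sets with compact closure. $\lim_{|\varphi(z)|\to1}F(z)=0$ means: for every $\varepsilon>0$ there is $\delta\in(0,1)$ such that $|F(z)|<\varepsilon$ for all $z\in D$ with $\delta<|\varphi(z)|<1$; it holds automatically if no sequence $(z_n)$ in $D$ satisfies $|\varphi(z_n)|\to1$. *)

theory Defs
  imports "HOL-Analysis.Analysis"
begin

abbreviation disk :: "complex set" where
  "disk \<equiv> ball 0 1"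

text \<open>
  Elements of the function spaces are made \<^const>\<open>extensional\<close>, so that two of them are
  equal as soon as they agree on the disk. Otherwise the Bloch norm would only be a seminorm.
\<close>

definition hol_disk :: "(complex \<Rightarrow> complex) set" where
  "hol_disk = {f. f holomorphic_on disk \<and> f \<in> extensional disk}"

definition weighted_comp ::
  "(complex \<Rightarrow> complex) \<Rightarrow> (complex \<Rightarrow> complex) \<Rightarrow> (complex \<Rightarrow> complex) \<Rightarrow> complex \<Rightarrow> complex" where
  "weighted_comp u varphi f = (\<lambda>z\<in>disk. u z * f (varphi z))"

text \<open>
  The arrows are monotone (not necessarily strict) convergence as \<open>r\<close> tends to 1, so
  monotonicity is only required on some interval \<open>[r\<^sub>0, 1)\<close>; \<open>r\<^sub>0 = 0\<close> is allowed.
\<close>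

definition normal_weight :: "(real \<Rightarrow> real) \<Rightarrow> bool" where
  "normal_weight \<phi> \<longleftrightarrow>
     continuous_on {0..<1} \<phi> \<and> (\<forall>r\<in>{0..<1}. 0 < \<phi> r) \<and>
     (\<exists>s t. 0 < s \<and> s < t \<and>
        (\<exists>r\<^sub>0\<in>{0..<1}.
           antimono_on {r\<^sub>0..<1} (\<lambda>r. \<phi> r / (1 - r) powr s) \<and>
           mono_on {r\<^sub>0..<1} (\<lambda>r. \<phi> r / (1 - r) powr t)) \<and>
        ((\<lambda>r. \<phi> r / (1 - r) powr s) \<longlongrightarrow> 0) (at_left 1) \<and>
        filterlim (\<lambda>r. \<phi> r / (1 - r) powr t) at_top (at_left 1))"

definition integral_mean :: "real \<Rightarrow> (complex \<Rightarrow> complex) \<Rightarrow> real \<Rightarrow> real" where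
  "integral_mean p f r =
     (1 / (2 * pi) * (LBINT \<theta>:{0..2 * pi}. cmod (f (of_real r * cis \<theta>)) powr p)) powr (1 / p)"

definition Hpp_integral :: "real \<Rightarrow> (real \<Rightarrow> real) \<Rightarrow> (complex \<Rightarrow> complex) \<Rightarrow> ennreal" where
  "Hpp_integral p \<phi> f =
     (\<integral>\<^sup>+r\<in>{0..<1}. ennreal (integral_mean p f r powr p * (\<phi> r powr p / (1 - r)) * r) \<partial>lborel)"

definition Hpp :: "real \<Rightarrow> (real \<Rightarrow> real) \<Rightarrow> (complex \<Rightarrow> complex) set" where
  "Hpp p \<phi> = {f \<in> hol_disk. Hpp_integral p \<phi> f < \<infinity>}"

definition Hpp_norm :: "real \<Rightarrow> (real \<Rightarrow> real) \<Rightarrow> (complex \<Rightarrow> complex) \<Rightarrow> real" where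
  "Hpp_norm p \<phi> f = enn2real (Hpp_integral p \<phi> f) powr (1 / p)"

definition bloch_seminorm :: "(complex \<Rightarrow> complex) \<Rightarrow> ennreal" where
  "bloch_seminorm f = (SUP z\<in>disk. ennreal ((1 - (cmod z)\<^sup>2) * cmod (deriv f z)))"

definition bloch :: "(complex \<Rightarrow> complex) set" where
  "bloch = {f \<in> hol_disk. bloch_seminorm f < \<infinity>}"

definition bloch_norm :: "(complex \<Rightarrow> complex) \<Rightarrow> real" where
  "bloch_norm f = cmod (f 0) + enn2real (bloch_seminorm f)"

definition bloch_dist :: "(complex \<Rightarrow> complex) \<Rightarrow> (complex \<Rightarrow> complex) \<Rightarrow> real" where
  "bloch_dist f g = bloch_norm (\<lambda>z. f z - g z)"

definition bloch_topology :: "(complex \<Rightarrow> complex) topology" where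
  "bloch_topology = Metric_space.mtopology bloch bloch_dist"

definition norm_bounded :: "('a \<Rightarrow> real) \<Rightarrow> 'a set \<Rightarrow> bool" where
  "norm_bounded N S \<longleftrightarrow> (\<exists>M. \<forall>f\<in>S. N f \<le> M)"

definition bounded_operator ::
  "'a set \<Rightarrow> ('a \<Rightarrow> real) \<Rightarrow> 'b set \<Rightarrow> ('b \<Rightarrow> real) \<Rightarrow> ('a \<Rightarrow> 'b) \<Rightarrow> bool" where
  "bounded_operator X NX Y NY T \<longleftrightarrow>
     T \<in> X \<rightarrow> Y \<and> (\<forall>S\<subseteq>X. norm_bounded NX S \<longrightarrow> norm_bounded NY (T ` S))"

definition compact_operator ::
  "'a set \<Rightarrow> ('a \<Rightarrow> real) \<Rightarrow> 'b topology \<Rightarrow> ('a \<Rightarrow> 'b) \<Rightarrow> bool" where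
  "compact_operator X NX TY T \<longleftrightarrow>
     T \<in> X \<rightarrow> topspace TY \<and>
     (\<forall>S\<subseteq>X. norm_bounded NX S \<longrightarrow> compactin TY (TY closure_of (T ` S)))"

definition tends_to_zero_at_boundary ::
  "(complex \<Rightarrow> complex) \<Rightarrow> (complex \<Rightarrow> real) \<Rightarrow> bool" where
  "tends_to_zero_at_boundary varphi F \<longleftrightarrow>
     (\<forall>\<epsilon>>0. \<exists>\<delta>\<in>{0<..<1}. \<forall>z\<in>disk. \<delta> < cmod (varphi z) \<and> cmod (varphi z) < 1 \<longrightarrow> \<bar>F z\<bar> < \<epsilon>)"

text \<open>
  \<^const>\<open>bloch_dist\<close> is a metric on \<^const>\<open>bloch\<close>, so \<^const>\<open>bloch_topology\<close> is
  the norm topology.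
\<close>

lemma disk_weight_nonneg: "z \<in> disk \<Longrightarrow> 0 \<le> 1 - (cmod z)\<^sup>2"
  by (simp add: power_le_one)

lemma bloch_seminorm_triangle:
  assumes "f holomorphic_on disk" "g holomorphic_on disk"
  shows "bloch_seminorm (\<lambda>z. f z + g z) \<le> bloch_seminorm f + bloch_seminorm g"
  unfolding bloch_seminorm_def
proof (rule SUP_least)
  fix z :: complex assume z: "z \<in> disk"
  let ?w = "1 - (cmod z)\<^sup>2"
  have fd: "f field_differentiable at z" "g field_differentiable at z"
    using assms z by (auto intro: holomorphic_on_imp_differentiable_at[OF _ open_ball])
  have "?w * cmod (deriv (\<lambda>z. f z + g z) z) \<le> ?w * cmod (deriv f z) + ?w * cmod (deriv g z)"
    using disk_weight_nonneg[OF z] norm_triangle_ineq[of "deriv f z" "deriv g z"]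
    by (simp add: deriv_add[OF fd] mult_left_mono flip: distrib_left)
  then have "ennreal (?w * cmod (deriv (\<lambda>z. f z + g z) z))
      \<le> ennreal (?w * cmod (deriv f z)) + ennreal (?w * cmod (deriv g z))"
    using disk_weight_nonneg[OF z] by (simp add: ennreal_leI flip: ennreal_plus)
  also have "\<dots> \<le> (SUP z\<in>disk. ennreal ((1 - (cmod z)\<^sup>2) * cmod (deriv f z))) +
      (SUP z\<in>disk. ennreal ((1 - (cmod z)\<^sup>2) * cmod (deriv g z)))"
    using z by (intro add_mono SUP_upper)
  finally show "ennreal (?w * cmod (deriv (\<lambda>z. f z + g z) z)) \<le> \<dots>" .
qed

lemma deriv_uminus_disk: "deriv (\<lambda>z. - f z) z = - deriv f z"
  if "f holomorphic_on disk" "z \<in> disk" for f :: "complex \<Rightarrow> complex"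
proof -
  have "f field_differentiable at z"
    using that by (auto intro: holomorphic_on_imp_differentiable_at[OF _ open_ball])
  then show ?thesis by simp
qed

lemma bloch_dist_commute: "bloch_dist f g = bloch_dist g f"
proof -
  have "cmod (deriv (\<lambda>z. f z - g z) z) = cmod (deriv (\<lambda>z. g z - f z) z)" for z
  proof (cases "(\<lambda>z. f z - g z) field_differentiable at z")
    case True
    then have "DERIV (\<lambda>z. f z - g z) z :> deriv (\<lambda>z. f z - g z) z"
      by (simp add: DERIV_deriv_iff_field_differentiable)
    from DERIV_imp_deriv[OF DERIV_minus[OF this]] show ?thesis by simp
  next
    case False
    have "\<not> (\<lambda>z. g z - f z) field_differentiable at z"
      using False field_differentiable_minus[of "\<lambda>z. g z - f z" "at z"] by auto
    with False have "(\<lambda>D. DERIV (\<lambda>z. f z - g z) z :> D) = (\<lambda>D. DERIV (\<lambda>z. g z - f z) z :> D)"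
      by (auto simp: field_differentiable_def)
    then show ?thesis by (simp add: deriv_def)
  qed
  then show ?thesis
    by (simp add: bloch_dist_def bloch_norm_def bloch_seminorm_def norm_minus_commute)
qed

lemma bloch_diff_finite:
  assumes "f \<in> bloch" "g \<in> bloch"
  shows "bloch_seminorm (\<lambda>z. f z - g z) < \<infinity>"
proof -
  have hol: "f holomorphic_on disk" "g holomorphic_on disk"
    using assms by (auto simp: bloch_def hol_disk_def)
  have "bloch_seminorm (\<lambda>z. - g z) = bloch_seminorm g"
    unfolding bloch_seminorm_def using hol(2) by (intro SUP_cong) (auto simp: deriv_uminus_disk)
  moreover have "bloch_seminorm (\<lambda>z. f z + - g z) \<le> bloch_seminorm f + bloch_seminorm (\<lambda>z. - g z)"
    using hol by (intro bloch_seminorm_triangle holomorphic_intros)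
  moreover have "bloch_seminorm f + bloch_seminorm g < \<infinity>"
    using assms by (simp add: bloch_def)
  ultimately show ?thesis by (auto intro: le_less_trans)
qed

lemma Metric_space_bloch: "Metric_space bloch bloch_dist"
proof
  show "0 \<le> bloch_dist f g" for f g
    by (simp add: bloch_dist_def bloch_norm_def)
  show "bloch_dist f g = bloch_dist g f" for f g
    by (rule bloch_dist_commute)
  show "bloch_dist f g = 0 \<longleftrightarrow> f = g" if fg: "f \<in> bloch" "g \<in> bloch" for f g
  proof
    assume "f = g"
    then show "bloch_dist f g = 0"
      by (simp add: bloch_dist_def bloch_norm_def bloch_seminorm_def)
  next
    assume d0: "bloch_dist f g = 0"
    let ?h = "\<lambda>z. f z - g z"
    have hol: "?h holomorphic_on disk"
      using fg by (auto simp: bloch_def hol_disk_def intro!: holomorphic_intros)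
    have "cmod (?h 0) \<ge> 0" "enn2real (bloch_seminorm ?h) \<ge> 0" by simp_all
    with d0 have h0: "?h 0 = 0" and "enn2real (bloch_seminorm ?h) = 0"
      unfolding bloch_dist_def bloch_norm_def by (auto simp: add_nonneg_eq_0_iff)
    then have "bloch_seminorm ?h = 0"
      using bloch_diff_finite[OF fg] by (auto simp: enn2real_eq_0_iff)
    then have D0: "deriv ?h z = 0" if "z \<in> disk" for z
    proof -
      have "ennreal ((1 - (cmod z)\<^sup>2) * cmod (deriv ?h z)) \<le> bloch_seminorm ?h"
        unfolding bloch_seminorm_def using that by (rule SUP_upper)
      with \<open>bloch_seminorm ?h = 0\<close> have "(1 - (cmod z)\<^sup>2) * cmod (deriv ?h z) \<le> 0"
        by (simp add: ennreal_eq_0_iff)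
      moreover have "1 - (cmod z)\<^sup>2 > 0"
        using that by (simp add: power_less_one_iff abs_square_less_1)
      ultimately show ?thesis
        by (simp add: mult_le_0_iff)
    qed
    have "(?h has_field_derivative 0) (at z within disk)" if "z \<in> disk" for z
      using holomorphic_derivI[OF hol open_ball that] D0[OF that]
      by (simp add: has_field_derivative_at_within)
    then obtain c where c: "\<And>z. z \<in> disk \<Longrightarrow> ?h z = c"
      using has_field_derivative_zero_constant[of disk ?h] by auto
    with h0 have "f z = g z" if "z \<in> disk" for z
      using c[of 0] c[OF that] by auto
    then show "f = g"
      using fg by (auto simp: bloch_def hol_disk_def intro: extensionalityI)
  qed
  show "bloch_dist f h \<le> bloch_dist f g + bloch_dist g h"
    if fgh: "f \<in> bloch" "g \<in> bloch" "h \<in> bloch" for f g h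
  proof -
    let ?a = "\<lambda>z. f z - g z" and ?b = "\<lambda>z. g z - h z"
    have "?a holomorphic_on disk" "?b holomorphic_on disk"
      using fgh by (auto simp: bloch_def hol_disk_def intro!: holomorphic_intros)
    from bloch_seminorm_triangle[OF this]
    have le: "bloch_seminorm (\<lambda>z. f z - h z) \<le> bloch_seminorm ?a + bloch_seminorm ?b"
      by simp
    have fin: "bloch_seminorm ?a < \<infinity>" "bloch_seminorm ?b < \<infinity>"
      using fgh by (blast intro: bloch_diff_finite)+
    have "enn2real (bloch_seminorm (\<lambda>z. f z - h z)) \<le> enn2real (bloch_seminorm ?a + bloch_seminorm ?b)"
      using le fin by (intro enn2real_mono) auto
    also have "\<dots> = enn2real (bloch_seminorm ?a) + enn2real (bloch_seminorm ?b)"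
      using fin by (simp add: enn2real_plus)
    finally show ?thesis
      using norm_triangle_ineq[of "f 0 - g 0" "g 0 - h 0"]
      by (simp add: bloch_dist_def bloch_norm_def)
  qed
qed

lemma topspace_bloch_topology: "topspace bloch_topology = bloch"
  unfolding bloch_topology_def by (rule Metric_space.topspace_mtopology[OF Metric_space_bloch])

end

theory Submission
  imports Defs "HOL-Complex_Analysis.Complex_Analysis"
begin

text \<open>
  Write \<open>q(z) = 1 - |z|\<^sup>2\<close>, let \<open>T\<close> be the weighted composition operator, and recall that
  \<open>(Tf)' = u' (f \<circ> varphi) + u varphi' (f' \<circ> varphi)\<close>. The two quotients in the theorem are the
  Bloch weights \<open>q |u'|\<close> and \<open>q |u varphi'|\<close> multiplied by the largest values that \<open>|f(w)|\<close> and
  \<open>|f'(w)|\<close> can take, up to constants, at \<open>w = varphi z\<close> for \<open>f\<close> in the unit ball of the domain space.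
  Two facts make this precise.

  The first is the growth estimate \<open>|f(w)| \<le> K \<parallel>f\<parallel> / (\<phi>(|w|) q(w) powr (1/p))\<close>, with one more
  power of \<open>q\<close> for \<open>f'\<close> (\<open>growth_estimate\<close> and \<open>deriv_growth_estimate\<close>). It rests on a local
  estimate of \<open>|f(z)| powr p\<close> by the integrals of \<open>|f| powr p\<close> over circles of radius near \<open>|z|\<close>
  (\<open>annulus_estimate\<close>), which replaces the subharmonicity of \<open>|f| powr p\<close> by Cauchy's formula
  applied at a point where a weighted power of \<open>|f|\<close> is maximal.

  The second is that the growth estimate is sharp: for every \<open>w\<close> there are combinations of
  \<open>(1 - cnj w z) ^ (- N)\<close> and \<open>(1 - cnj w z) ^ (- N - 1)\<close>, normalised to have bounded norm, for
  which at \<open>w\<close> either the value has the extremal size and the derivative vanishes, or the value vanishes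
  and the derivative has the extremal size up to the factor \<open>|w|\<close>. As \<open>|w|\<close> tends to 1 they tend to 0 pointwise together with their derivatives
  (\<open>test_function_Hpp_norm_bound\<close>, \<open>test_function_at_centre\<close>, \<open>test_function_tendsto_0\<close>).

  If \<open>T\<close> is compact, the images of the test functions with \<open>w = varphi (z n)\<close>, where
  \<open>|varphi (z n)|\<close> tends to 1, have a subsequence that converges in the Bloch space. Pointwise
  convergence shows that the limit has derivative 0, so the Bloch seminorms tend to 0, and evaluation
  at \<open>z n\<close> gives both conditions. Conversely, by the growth estimate and Montel's theorem a bounded
  sequence has a subsequence with a locally uniform limit \<open>g\<close>, which obeys the same growth estimate.
  For \<open>h = f n - g\<close> the expression \<open>q |(Th)'|\<close> is small where \<open>|varphi|\<close> is near 1 by the two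
  conditions, and elsewhere by uniform convergence, since \<open>q |u'|\<close> and \<open>q |u varphi'|\<close> are bounded
  (apply \<open>T\<close> to the functions 1 and \<open>z\<close>). Hence \<open>T (f n)\<close> converges to \<open>T g\<close> in the Bloch space.
\<close>

section \<open>Normal weights\<close>

text \<open>
  On the compact interval where monotonicity is not assumed, a positive continuous function lies
  between two positive constants, and their quotient is the price for monotonicity everywhere.
\<close>

lemma eventually_antimono_imp_almost_antimono:
  fixes g :: "real \<Rightarrow> real"
  assumes cont: "continuous_on {0..<1} g" and pos: "\<And>x. x \<in> {0..<1} \<Longrightarrow> 0 < g x"
    and r0: "r0 \<in> {0..<1}" and anti: "antimono_on {r0..<1} g"
  obtains C where "1 \<le> C" "\<And>x y. 0 \<le> x \<Longrightarrow> x \<le> y \<Longrightarrow> y < 1 \<Longrightarrow> g y \<le> C * g x"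
proof -
  have c: "continuous_on {0..r0} g"
    by (rule continuous_on_subset[OF cont]) (use r0 in auto)
  have ne: "{0..r0} \<noteq> {}" using r0 by auto
  obtain a where a: "a \<in> {0..r0}" "\<And>y. y \<in> {0..r0} \<Longrightarrow> g a \<le> g y"
    using continuous_attains_inf[OF compact_Icc ne c] by blast
  obtain b where b: "b \<in> {0..r0}" "\<And>y. y \<in> {0..r0} \<Longrightarrow> g y \<le> g b"
    using continuous_attains_sup[OF compact_Icc ne c] by blast
  have ga: "0 < g a" using a(1) r0 by (intro pos) auto
  define C where "C = g b / g a"
  have C1: "1 \<le> C" using ga b(2)[OF a(1)] by (simp add: C_def)
  have low: "g b \<le> C * g x" if "x \<in> {0..r0}" for x
  proof -
    have "0 < g b" using b(1) r0 by (intro pos) auto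
    then have "C * g a \<le> C * g x"
      using a(2)[OF that] C1 by (intro mult_left_mono) auto
    then show ?thesis using ga by (simp add: C_def)
  qed
  have "g y \<le> C * g x" if xy: "0 \<le> x" "x \<le> y" "y < 1" for x y
  proof (cases "r0 \<le> x")
    case True
    then have "g y \<le> g x" using anti xy r0 by (auto simp: monotone_on_def)
    also have "\<dots> \<le> C * g x" using C1 pos[of x] xy by simp
    finally show ?thesis .
  next
    case False
    have "g y \<le> g b"
    proof (cases "y \<le> r0")
      case True
      then show ?thesis using b(2)[of y] xy by auto
    next
      case False
      then have "g y \<le> g r0" using anti xy r0 by (auto simp: monotone_on_def)
      also have "\<dots> \<le> g b" using b(2)[of r0] r0 by auto
      finally show ?thesis .
    qed
    also have "\<dots> \<le> C * g x" using False xy by (intro low) auto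
    finally show ?thesis .
  qed
  with C1 that show thesis by blast
qed

text \<open>
  The two power bounds of a normal weight in a form that, up to a constant, holds between
  arbitrary radii instead of radii near 1.
\<close>

locale growth_weight =
  fixes \<phi> :: "real \<Rightarrow> real" and s t C :: real
  assumes pos: "\<And>r. 0 \<le> r \<Longrightarrow> r < 1 \<Longrightarrow> 0 < \<phi> r"
    and s_pos: "0 < s" and t_pos: "0 < t" and C_ge_1: "1 \<le> C"
    and upper: "\<And>x y. 0 \<le> x \<Longrightarrow> x \<le> y \<Longrightarrow> y < 1 \<Longrightarrow> \<phi> y \<le> C * \<phi> x * ((1 - y) / (1 - x)) powr s"
    and lower: "\<And>x y. 0 \<le> x \<Longrightarrow> x \<le> y \<Longrightarrow> y < 1 \<Longrightarrow> \<phi> x \<le> C * \<phi> y * ((1 - x) / (1 - y)) powr t"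

lemma normal_weight_imp_growth_weight:
  assumes "normal_weight \<phi>"
  obtains s t C where "growth_weight \<phi> s t C"
proof -
  from assms obtain s t r0 where cont: "continuous_on {0..<1} \<phi>"
    and pos: "\<And>r. r \<in> {0..<1} \<Longrightarrow> 0 < \<phi> r" and st: "0 < s" "s < t"
    and r0: "r0 \<in> {0..<1}" and anti: "antimono_on {r0..<1} (\<lambda>r. \<phi> r / (1 - r) powr s)"
    and mono: "mono_on {r0..<1} (\<lambda>r. \<phi> r / (1 - r) powr t)"
    unfolding normal_weight_def by blast
  have c1: "continuous_on {0..<1} (\<lambda>r. \<phi> r / (1 - r) powr s)"
    using cont by (auto intro!: continuous_intros)
  have c2: "continuous_on {0..<1} (\<lambda>r. (1 - r) powr t / \<phi> r)"
    using cont pos by (fastforce intro!: continuous_intros)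
  have anti2: "antimono_on {r0..<1} (\<lambda>r. (1 - r) powr t / \<phi> r)"
  proof (rule monotone_onI)
    fix x y assume xy: "x \<in> {r0..<1}" "y \<in> {r0..<1}" "x \<le> y"
    then have "\<phi> x / (1 - x) powr t \<le> \<phi> y / (1 - y) powr t"
      using mono by (auto simp: monotone_on_def)
    moreover have "0 < \<phi> x" "0 < \<phi> y" "x < 1" "y < 1" using xy r0 pos by auto
    ultimately show "(1 - y) powr t / \<phi> y \<le> (1 - x) powr t / \<phi> x"
      by (simp add: field_simps)
  qed
  obtain C1 where C1: "1 \<le> C1"
    "\<And>x y. 0 \<le> x \<Longrightarrow> x \<le> y \<Longrightarrow> y < 1 \<Longrightarrow> \<phi> y / (1 - y) powr s \<le> C1 * (\<phi> x / (1 - x) powr s)"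
    by (rule eventually_antimono_imp_almost_antimono[OF c1 _ r0 anti]) (use pos in auto)
  obtain C2 where C2: "1 \<le> C2"
    "\<And>x y. 0 \<le> x \<Longrightarrow> x \<le> y \<Longrightarrow> y < 1 \<Longrightarrow> (1 - y) powr t / \<phi> y \<le> C2 * ((1 - x) powr t / \<phi> x)"
    by (rule eventually_antimono_imp_almost_antimono[OF c2 _ r0 anti2]) (use pos in auto)
  define C where "C = max C1 C2"
  have "growth_weight \<phi> s t C"
  proof
    fix x y :: real assume xy: "0 \<le> x" "x \<le> y" "y < 1"
    then have ps: "0 < \<phi> x" "0 < \<phi> y" using pos by auto
    have "\<phi> y \<le> C1 * \<phi> x * ((1 - y) / (1 - x)) powr s"
      using C1(2)[OF xy] xy ps by (simp add: powr_divide field_simps)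
    also have "\<dots> \<le> C * \<phi> x * ((1 - y) / (1 - x)) powr s"
      using ps by (intro mult_right_mono) (auto simp: C_def)
    finally show "\<phi> y \<le> C * \<phi> x * ((1 - y) / (1 - x)) powr s" .
    have "\<phi> x \<le> C2 * \<phi> y * ((1 - x) / (1 - y)) powr t"
      using C2(2)[OF xy] xy ps by (simp add: powr_divide field_simps)
    also have "\<dots> \<le> C * \<phi> y * ((1 - x) / (1 - y)) powr t"
      using ps by (intro mult_right_mono) (auto simp: C_def)
    finally show "\<phi> x \<le> C * \<phi> y * ((1 - x) / (1 - y)) powr t" .
  qed (use pos st C1 in \<open>auto simp: C_def\<close>)
  with that show thesis by blast
qed

context growth_weight
begin

text \<open>
  The condition \<open>r \<le> (1 + a) / 2\<close> covers all points whose distance from a point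
  of modulus \<open>a\<close> is at most half its distance from the unit circle.
\<close>

lemma local_comparison:
  assumes "0 \<le> a" "a < 1" "0 \<le> r" "r \<le> (1 + a) / 2"
  shows "\<phi> a \<le> C * 2 powr t * \<phi> r"
proof -
  have ps: "0 < \<phi> a" "0 < \<phi> r" using assms by (auto intro!: pos)
  have two: "1 \<le> (2::real) powr t" using t_pos by (simp add: ge_one_powr_ge_zero)
  show ?thesis
  proof (cases "a \<le> r")
    case True
    have "\<phi> a \<le> C * \<phi> r * ((1 - a) / (1 - r)) powr t"
      using True assms by (intro lower) auto
    also have "\<dots> \<le> C * \<phi> r * 2 powr t"
      using assms True ps C_ge_1 t_pos
      by (intro mult_left_mono powr_mono2) (auto simp: field_simps)
    finally show ?thesis by (simp add: mult_ac)
  next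
    case False
    have "\<phi> a \<le> C * \<phi> r * ((1 - a) / (1 - r)) powr s"
      using False assms by (intro upper) auto
    also have "\<dots> \<le> C * \<phi> r * 1 powr s"
      using assms False ps C_ge_1 s_pos
      by (intro mult_left_mono powr_mono2) (auto simp: field_simps)
    also have "\<dots> \<le> C * \<phi> r * 2 powr t"
      using two ps C_ge_1 by (intro mult_left_mono) auto
    finally show ?thesis by (simp add: mult_ac)
  qed
qed

end

section \<open>Local estimates from means over circles\<close>

lemma continuous_on_circle:
  fixes f :: "complex \<Rightarrow> complex"
  assumes f: "f holomorphic_on disk" and r: "0 \<le> r" "r < 1"
  shows "continuous_on {0..2 * pi} (\<lambda>\<theta>. f (of_real r * cis \<theta>))"
proof -
  have "continuous_on disk f" using f by (rule holomorphic_on_imp_continuous_on)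
  then show ?thesis
    by (rule continuous_on_compose2) (use r in \<open>auto intro!: continuous_intros simp: norm_mult\<close>)
qed

lemma continuous_on_circle_powr:
  fixes f :: "complex \<Rightarrow> complex"
  assumes "f holomorphic_on disk" "0 \<le> r" "r < 1" "0 < p"
  shows "continuous_on {0..2 * pi} (\<lambda>\<theta>. cmod (f (of_real r * cis \<theta>)) powr p)"
  using assms by (intro continuous_on_powr' continuous_intros continuous_on_circle) auto

lemma integral_mean_powr:
  assumes f: "f holomorphic_on disk" and r: "0 \<le> r" "r < 1" and p: "0 < p"
  shows "integral_mean p f r powr p
    = integral {0..2 * pi} (\<lambda>\<theta>. cmod (f (of_real r * cis \<theta>)) powr p) / (2 * pi)"
proof -
  let ?g = "\<lambda>\<theta>. cmod (f (of_real r * cis \<theta>)) powr p"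
  have "set_integrable lborel {0..2 * pi} ?g"
    by (intro borel_integrable_atLeastAtMost' continuous_on_circle_powr assms)
  then have e: "(LBINT \<theta>:{0..2 * pi}. ?g \<theta>) = integral {0..2 * pi} ?g"
    by (rule set_borel_integral_eq_integral)
  have "0 \<le> integral {0..2 * pi} ?g"
    by (intro integral_nonneg integrable_continuous_interval continuous_on_circle_powr assms) auto
  then show ?thesis
    unfolding integral_mean_def e using p by (simp add: powr_powr)
qed

text \<open>
  Cauchy's formula on the circle of radius \<open>r\<close>, where the kernel is at most \<open>1 / (r - |z|)\<close>.
\<close>

lemma Cauchy_circle_bound:
  assumes f: "f holomorphic_on disk" and r: "cmod z < r" "r < 1"
  shows "cmod (f z) \<le> r / (r - cmod z) / (2 * pi) * integral {0..2 * pi} (\<lambda>\<theta>. cmod (f (of_real r * cis \<theta>)))"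
proof -
  have r0: "0 < r" using r norm_ge_zero[of z] by linarith
  have "f holomorphic_on cball 0 r"
    using f by (rule holomorphic_on_subset) (use r in auto)
  then have "((\<lambda>u. f u / (u - z)) has_contour_integral (2 * of_real pi * \<i> * f z)) (circlepath 0 r)"
    using r by (intro Cauchy_integral_circlepath_simple) auto
  then have hi: "((\<lambda>\<theta>. f (0 + r * cis \<theta>) / (0 + r * cis \<theta> - z) * r * \<i> * cis \<theta>) has_integral
      (2 * of_real pi * \<i> * f z)) {0..2 * pi}"
    unfolding circlepath_def by (subst (asm) has_contour_integral_part_circlepath_iff) auto
  have "2 * pi * cmod (f z) = cmod (2 * of_real pi * \<i> * f z)"
    by (simp add: norm_mult)
  also have "\<dots> = cmod (integral {0..2 * pi} (\<lambda>\<theta>. f (0 + r * cis \<theta>) / (0 + r * cis \<theta> - z) * r * \<i> * cis \<theta>))"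
    using hi by (simp add: integral_unique)
  also have "\<dots> \<le> integral {0..2 * pi} (\<lambda>\<theta>. r / (r - cmod z) * cmod (f (of_real r * cis \<theta>)))"
  proof (rule integral_norm_bound_integral)
    show "(\<lambda>\<theta>. f (0 + r * cis \<theta>) / (0 + r * cis \<theta> - z) * r * \<i> * cis \<theta>) integrable_on {0..2 * pi}"
      using hi by (rule has_integral_integrable)
    show "(\<lambda>\<theta>. r / (r - cmod z) * cmod (f (of_real r * cis \<theta>))) integrable_on {0..2 * pi}"
      using f r r0 by (intro integrable_continuous_interval continuous_intros continuous_on_circle) auto
    fix \<theta> :: real
    have "r - cmod z \<le> cmod (r * cis \<theta> - z)"
      using norm_triangle_ineq2[of "r * cis \<theta>" z] r0 by (simp add: norm_mult)
    then have "cmod (f (r * cis \<theta>)) * r / cmod (r * cis \<theta> - z) \<le> cmod (f (r * cis \<theta>)) * r / (r - cmod z)"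
      using r r0 by (intro divide_left_mono mult_pos_pos) auto
    then show "cmod (f (0 + r * cis \<theta>) / (0 + r * cis \<theta> - z) * r * \<i> * cis \<theta>)
        \<le> r / (r - cmod z) * cmod (f (of_real r * cis \<theta>))"
      using r0 by (simp add: norm_mult norm_divide mult_ac)
  qed
  finally show ?thesis
    using r by (simp add: field_simps)
qed

text \<open>
  Since Cauchy's formula only controls first powers, for \<open>p < 1\<close> it is applied at a point \<open>z0\<close> where
  \<open>(\<delta> - \<bar>|w| - |z|\<bar>)\<^sup>2 |f w| powr p\<close> is maximal in the annulus of half-width \<open>\<delta>\<close> around the circle
  through \<open>z\<close>. If \<open>e\<close> is the distance of \<open>|z0|\<close> from the boundary radii, then \<open>|f|\<close> is at most a
  constant times \<open>|f z0|\<close> on the circles with radius between \<open>|z0| + e/3\<close> and \<open>|z0| + 2e/3\<close>.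
  There \<open>|f| = |f| powr (1 - p) |f| powr p\<close>, the first factor can be absorbed on the left-hand side,
  and what remains is an estimate of \<open>|f z0| powr p\<close>, hence of \<open>|f z| powr p\<close>.
  
  The estimate is stated for every radius of a suitable interval of length \<open>d\<close> instead of for
  the mean over that interval, so that it can be multiplied by any weight before it is integrated.
\<close>

lemma annulus_estimate_le_1:
  assumes p: "0 < p" "p \<le> 1"
  obtains c where "0 < c"
    "\<And>f z \<delta>. f holomorphic_on disk \<Longrightarrow> 0 < \<delta> \<Longrightarrow> cmod z + \<delta> < 1 \<Longrightarrow>
       \<exists>d \<alpha>. 0 < d \<and> 0 \<le> \<alpha> \<and> cmod z - \<delta> \<le> \<alpha> \<and> \<alpha> + d \<le> cmod z + \<delta> \<and>
         (\<forall>r\<in>{\<alpha>..\<alpha> + d}. c * \<delta>\<^sup>2 * cmod (f z) powr p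
            \<le> d * integral {0..2 * pi} (\<lambda>\<theta>. cmod (f (of_real r * cis \<theta>)) powr p))"
proof -
  \<comment> \<open>Passing to the circles in question loses at most a factor 3 in the distance to the boundary radii,
    hence a factor 9 in \<open>|f| powr p\<close>; \<open>Q\<close> is the resulting factor in \<open>|f| powr (1 - p)\<close>.\<close>
  define Q :: real where "Q = 9 powr ((1 - p) / p)"
  define c :: real where "c = 2 * pi / (9 * Q)"
  have Q: "0 < Q" by (simp add: Q_def)
  have c: "0 < c" using Q by (simp add: c_def)
  have main: "\<exists>d \<alpha>. 0 < d \<and> 0 \<le> \<alpha> \<and> cmod z - \<delta> \<le> \<alpha> \<and> \<alpha> + d \<le> cmod z + \<delta> \<and>
         (\<forall>r\<in>{\<alpha>..\<alpha> + d}. c * \<delta>\<^sup>2 * cmod (f z) powr p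
            \<le> d * integral {0..2 * pi} (\<lambda>\<theta>. cmod (f (of_real r * cis \<theta>)) powr p))"
    if f: "f holomorphic_on disk" and \<delta>: "0 < \<delta>" and z1: "cmod z + \<delta> < 1" for f z \<delta>
  proof -
    let ?I = "\<lambda>r. integral {0..2 * pi} (\<lambda>\<theta>. cmod (f (of_real r * cis \<theta>)) powr p)"
    have I0: "0 \<le> ?I r" if "0 \<le> r" "r < 1" for r
      using that f p by (intro integral_nonneg integrable_continuous_interval continuous_on_circle_powr) auto
    show ?thesis
    proof (cases "f z = 0")
      case True
      show ?thesis
      proof (intro exI conjI ballI)
        show "0 < \<delta>" "0 \<le> cmod z" "cmod z - \<delta> \<le> cmod z" "cmod z + \<delta> \<le> cmod z + \<delta>"
          using \<delta> by auto
        fix r assume "r \<in> {cmod z..cmod z + \<delta>}"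
        then have "0 \<le> r" "r < 1" using z1 norm_ge_zero[of z] by (simp_all add: order_trans[of 0 "cmod z"])
        then show "c * \<delta>\<^sup>2 * cmod (f z) powr p \<le> \<delta> * ?I r"
          using True \<delta> I0[of r] by auto
      qed
    next
      case nz: False
      define K where "K = {w. \<bar>cmod w - cmod z\<bar> \<le> \<delta>}"
      have K1: "cmod w < 1" if "w \<in> K" for w using that z1 by (auto simp: K_def)
      have "closed K" unfolding K_def by (intro closed_Collect_le continuous_intros)
      moreover have "bounded K"
        using K1 by (intro boundedI[of _ 1]) (auto intro: less_imp_le)
      ultimately have "compact K" by (simp add: compact_eq_bounded_closed)
      moreover have zK: "z \<in> K" using \<delta> by (simp add: K_def)
      moreover have "continuous_on K f"
        by (rule continuous_on_subset[OF holomorphic_on_imp_continuous_on[OF f]]) (use K1 in auto)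
      ultimately obtain z0 where z0: "z0 \<in> K" and max:
        "\<And>w. w \<in> K \<Longrightarrow> (\<delta> - \<bar>cmod w - cmod z\<bar>)\<^sup>2 * cmod (f w) powr p
           \<le> (\<delta> - \<bar>cmod z0 - cmod z\<bar>)\<^sup>2 * cmod (f z0) powr p"
        using continuous_attains_sup[of K "\<lambda>w. (\<delta> - \<bar>cmod w - cmod z\<bar>)\<^sup>2 * cmod (f w) powr p"] p
        by (force intro!: continuous_intros continuous_on_powr')
      \<comment> \<open>The exponent 2 of the distance makes up for the length of the interval of radii
        and for the size of the Cauchy kernel, each of which costs one factor.\<close>
      define e where "e = \<delta> - \<bar>cmod z0 - cmod z\<bar>"
      have mz: "\<delta>\<^sup>2 * cmod (f z) powr p \<le> e\<^sup>2 * cmod (f z0) powr p"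
        using max[OF zK] by (simp add: e_def)
      have "0 < \<delta>\<^sup>2 * cmod (f z) powr p" using nz \<delta> by simp
      with mz have pp: "0 < e\<^sup>2 * cmod (f z0) powr p" by linarith
      then have e0: "0 < e" using z0 by (auto simp: e_def K_def less_le)
      have z0_range: "cmod z - \<delta> + e \<le> cmod z0" "cmod z0 \<le> cmod z + \<delta> - e"
        unfolding e_def by (auto simp: abs_if)
      have fz0: "f z0 \<noteq> 0" using pp by auto
      show ?thesis
      proof (intro exI conjI ballI)
        show "0 < e / 3" "0 \<le> cmod z0 + e / 3" using e0 by auto
        show "cmod z - \<delta> \<le> cmod z0 + e / 3" "cmod z0 + e / 3 + e / 3 \<le> cmod z + \<delta>"
          using e0 z0_range by auto
        fix r assume r: "r \<in> {cmod z0 + e / 3..cmod z0 + e / 3 + e / 3}"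
        have r0: "0 < r" using r e0 norm_ge_zero[of z0] unfolding atLeastAtMost_iff by linarith
        have r_in: "\<bar>r - cmod z\<bar> \<le> \<delta> - e / 3" using r e0 z0_range by (auto simp: abs_le_iff)
        then have r1: "r < 1" using z1 e0 by auto
        have rz0: "cmod z0 < r" using r e0 by auto
        have circ: "cmod (f w) \<le> Q * cmod (f z0) powr (1 - p) * cmod (f w) powr p" if w: "cmod w = r" for w
        proof -
          have "(e / 3)\<^sup>2 * cmod (f w) powr p \<le> (\<delta> - \<bar>cmod w - cmod z\<bar>)\<^sup>2 * cmod (f w) powr p"
            using r_in e0 w by (intro mult_right_mono power_mono) auto
          also have "\<dots> \<le> e\<^sup>2 * cmod (f z0) powr p"
            unfolding e_def using r_in e0 w by (intro max) (auto simp: K_def)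
          finally have "cmod (f w) powr p \<le> 9 * cmod (f z0) powr p"
            using e0 by (simp add: power_divide field_simps)
          then have "(cmod (f w) powr p) powr ((1 - p) / p) \<le> (9 * cmod (f z0) powr p) powr ((1 - p) / p)"
            using p by (intro powr_mono2) auto
          then have "cmod (f w) powr (1 - p) \<le> Q * cmod (f z0) powr (1 - p)"
            using p by (simp add: powr_powr powr_mult Q_def)
          then have "cmod (f w) powr (1 - p) * cmod (f w) powr p \<le> Q * cmod (f z0) powr (1 - p) * cmod (f w) powr p"
            by (intro mult_right_mono) auto
          then show ?thesis by (simp flip: powr_add)
        qed
        have "integral {0..2 * pi} (\<lambda>\<theta>. cmod (f (of_real r * cis \<theta>)))
            \<le> integral {0..2 * pi} (\<lambda>\<theta>. Q * cmod (f z0) powr (1 - p) * cmod (f (of_real r * cis \<theta>)) powr p)"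
          using r0 r1 f p
          by (intro integral_le circ integrable_continuous_interval continuous_intros
              continuous_on_circle continuous_on_circle_powr) (auto simp: norm_mult)
        then have M: "integral {0..2 * pi} (\<lambda>\<theta>. cmod (f (of_real r * cis \<theta>))) \<le> Q * cmod (f z0) powr (1 - p) * ?I r"
          by simp
        have k: "r / (r - cmod z0) \<le> 3 / e"
          using frac_le[of 1 r "e / 3" "r - cmod z0"] r r0 r1 e0 by simp
        have "cmod (f z0) \<le> r / (r - cmod z0) / (2 * pi) * integral {0..2 * pi} (\<lambda>\<theta>. cmod (f (of_real r * cis \<theta>)))"
          by (rule Cauchy_circle_bound[OF f rz0 r1])
        also have "\<dots> \<le> 3 / e / (2 * pi) * (Q * cmod (f z0) powr (1 - p) * ?I r)"
          using k M e0 r0 r1 f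
          by (intro mult_mono divide_right_mono integral_nonneg integrable_continuous_interval
              continuous_intros continuous_on_circle) auto
        finally have A: "cmod (f z0) \<le> 3 / e / (2 * pi) * (Q * cmod (f z0) powr (1 - p) * ?I r)" .
        have "cmod (f z0) powr p * cmod (f z0) powr (1 - p) = cmod (f z0)"
          using fz0 by (simp flip: powr_add)
        with A have "cmod (f z0) powr p * cmod (f z0) powr (1 - p)
            \<le> (3 / e / (2 * pi) * Q * ?I r) * cmod (f z0) powr (1 - p)"
          by (simp add: mult_ac)
        then have B: "cmod (f z0) powr p \<le> 3 / e / (2 * pi) * Q * ?I r"
          by (rule mult_right_le_imp_le) (use fz0 in auto)
        have "c * \<delta>\<^sup>2 * cmod (f z) powr p \<le> c * (e\<^sup>2 * cmod (f z0) powr p)"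
          using mz c by simp
        also have "\<dots> \<le> c * (e\<^sup>2 * (3 / e / (2 * pi) * Q * ?I r))"
          using B c by (intro mult_left_mono) auto
        also have "\<dots> = e / 3 * ?I r"
          using Q e0 by (simp add: c_def field_simps power2_eq_square)
        finally show "c * \<delta>\<^sup>2 * cmod (f z) powr p \<le> e / 3 * ?I r" .
      qed
    qed
  qed
  from that[OF c main] show thesis by blast
qed

lemma power_powr_divide:
  fixes x p :: real
  assumes "0 \<le> x" "0 < n"
  shows "(x ^ n) powr (p / real n) = x powr p"
proof (cases "x = 0")
  case False
  then have "(x ^ n) powr (p / real n) = (x powr real n) powr (p / real n)"
    using assms by (simp add: powr_realpow)
  then show ?thesis using assms by (simp add: powr_powr)
qed (use assms in auto)

text \<open>
  For \<open>p > 1\<close> the case of exponents at most 1 is applied to \<open>f ^ n\<close> and \<open>p / n\<close> with \<open>n \<ge> p\<close>.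
\<close>

lemma annulus_estimate:
  assumes p: "0 < p"
  obtains c where "0 < c"
    "\<And>f z \<delta>. f holomorphic_on disk \<Longrightarrow> 0 < \<delta> \<Longrightarrow> cmod z + \<delta> < 1 \<Longrightarrow>
       \<exists>d \<alpha>. 0 < d \<and> 0 \<le> \<alpha> \<and> cmod z - \<delta> \<le> \<alpha> \<and> \<alpha> + d \<le> cmod z + \<delta> \<and>
         (\<forall>r\<in>{\<alpha>..\<alpha> + d}. c * \<delta>\<^sup>2 * cmod (f z) powr p
            \<le> d * integral {0..2 * pi} (\<lambda>\<theta>. cmod (f (of_real r * cis \<theta>)) powr p))"
proof -
  define n where "n = nat \<lceil>p\<rceil>"
  have n: "0 < n" "p \<le> real n" using p by (auto simp: n_def)
  define q where "q = p / real n"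
  have q: "0 < q" "q \<le> 1" using p n by (auto simp: q_def)
  have pw: "cmod (f w ^ n) powr q = cmod (f w) powr p" for f :: "complex \<Rightarrow> complex" and w
    unfolding q_def norm_power using n by (intro power_powr_divide) auto
  obtain c where c: "0 < c"
    "\<And>f z \<delta>. f holomorphic_on disk \<Longrightarrow> 0 < \<delta> \<Longrightarrow> cmod z + \<delta> < 1 \<Longrightarrow>
       \<exists>d \<alpha>. 0 < d \<and> 0 \<le> \<alpha> \<and> cmod z - \<delta> \<le> \<alpha> \<and> \<alpha> + d \<le> cmod z + \<delta> \<and>
         (\<forall>r\<in>{\<alpha>..\<alpha> + d}. c * \<delta>\<^sup>2 * cmod (f z) powr q
            \<le> d * integral {0..2 * pi} (\<lambda>\<theta>. cmod (f (of_real r * cis \<theta>)) powr q))"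
    by (rule annulus_estimate_le_1[OF q]) blast
  show thesis
  proof (rule that[OF c(1)])
    fix f z and \<delta> :: real
    assume f: "f holomorphic_on disk" and h: "0 < \<delta>" "cmod z + \<delta> < 1"
    from f have "(\<lambda>z. f z ^ n) holomorphic_on disk" by (intro holomorphic_intros)
    from c(2)[OF this h]
    show "\<exists>d \<alpha>. 0 < d \<and> 0 \<le> \<alpha> \<and> cmod z - \<delta> \<le> \<alpha> \<and> \<alpha> + d \<le> cmod z + \<delta> \<and>
         (\<forall>r\<in>{\<alpha>..\<alpha> + d}. c * \<delta>\<^sup>2 * cmod (f z) powr p
            \<le> d * integral {0..2 * pi} (\<lambda>\<theta>. cmod (f (of_real r * cis \<theta>)) powr p))"
      unfolding pw .
  qed
qed

section \<open>Growth of functions in the mixed norm space\<close>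

lemma compact_subset_disk:
  assumes "compact K" "K \<subseteq> disk"
  obtains \<rho> where "0 \<le> \<rho>" "\<rho> < 1" "\<And>z. z \<in> K \<Longrightarrow> cmod z \<le> \<rho>"
proof (cases "K = {}")
  case True
  then show thesis using that[of 0] by auto
next
  case False
  then obtain a where "a \<in> K" "\<And>z. z \<in> K \<Longrightarrow> cmod z \<le> cmod a"
    using continuous_attains_sup[OF assms(1) False, of cmod] by (auto intro: continuous_intros)
  then show thesis using that[of "cmod a"] assms(2) by auto
qed

definition growth_bounded :: "real \<Rightarrow> (real \<Rightarrow> real) \<Rightarrow> real \<Rightarrow> (complex \<Rightarrow> complex) \<Rightarrow> bool" where
  "growth_bounded p \<phi> A f \<longleftrightarrow>
     (\<forall>z\<in>disk. cmod (f z) * (\<phi> (cmod z) * (1 - (cmod z)\<^sup>2) powr (1 / p)) \<le> A)"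

context growth_weight
begin

text \<open>
  Integrating the constant \<open>X\<close> over the interval turns a pointwise bound of the integrand
  into a bound by the norm.
\<close>

lemma const_le_Hpp_integral:
  assumes d: "0 \<le> \<alpha>" "0 \<le> d" "\<alpha> + d < 1" and X: "0 \<le> X" and M: "0 \<le> M" "Hpp_integral p \<phi> f \<le> ennreal M"
    and le: "\<And>r. \<alpha> \<le> r \<Longrightarrow> r \<le> \<alpha> + d \<Longrightarrow> X \<le> integral_mean p f r powr p * (\<phi> r powr p / (1 - r)) * r"
  shows "X * d \<le> M"
proof -
  have "ennreal (X * d) = (\<integral>\<^sup>+ r. ennreal X * indicator {\<alpha>..\<alpha> + d} r \<partial>lborel)"
    using d X by (simp add: nn_integral_cmult_indicator ennreal_mult)
  also have "\<dots> \<le> Hpp_integral p \<phi> f"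
    unfolding Hpp_integral_def
  proof (rule nn_integral_mono)
    fix r
    show "ennreal X * indicator {\<alpha>..\<alpha> + d} r
        \<le> ennreal (integral_mean p f r powr p * (\<phi> r powr p / (1 - r)) * r) * indicator {0..<1} r"
    proof (cases "r \<in> {\<alpha>..\<alpha> + d}")
      case True
      then have "X \<le> integral_mean p f r powr p * (\<phi> r powr p / (1 - r)) * r" by (intro le) auto
      moreover have "r \<in> {0..<1}" using True d by auto
      ultimately show ?thesis using True by (simp add: ennreal_leI)
    qed auto
  qed
  also have "\<dots> \<le> ennreal M" by (rule M)
  finally show ?thesis using M by (simp add: ennreal_le_iff)
qed

text \<open>
  With half-width \<open>(1 - |z|) / 2\<close> the annulus stays within radii on which \<open>\<phi>\<close> and \<open>1 - r\<close> are
  comparable with their values at \<open>|z|\<close>; \<open>|z| \<ge> 1/2\<close> keeps it away from the origin, where the factor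
  \<open>r\<close> of the measure degenerates.
\<close>

lemma powr_growth_estimate_outer:
  assumes p: "0 < p"
  obtains K where "0 < K"
    "\<And>f M z. f holomorphic_on disk \<Longrightarrow> 0 \<le> M \<Longrightarrow> Hpp_integral p \<phi> f \<le> ennreal M \<Longrightarrow>
       1 / 2 \<le> cmod z \<Longrightarrow> cmod z < 1 \<Longrightarrow> \<phi> (cmod z) powr p * (1 - cmod z) * cmod (f z) powr p \<le> K * M"
proof -
  obtain c where c: "0 < c"
    "\<And>f z \<delta>. f holomorphic_on disk \<Longrightarrow> 0 < \<delta> \<Longrightarrow> cmod z + \<delta> < 1 \<Longrightarrow>
       \<exists>d \<alpha>. 0 < d \<and> 0 \<le> \<alpha> \<and> cmod z - \<delta> \<le> \<alpha> \<and> \<alpha> + d \<le> cmod z + \<delta> \<and>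
         (\<forall>r\<in>{\<alpha>..\<alpha> + d}. c * \<delta>\<^sup>2 * cmod (f z) powr p
            \<le> d * integral {0..2 * pi} (\<lambda>\<theta>. cmod (f (of_real r * cis \<theta>)) powr p))"
    by (rule annulus_estimate[OF p]) blast
  define D where "D = C * 2 powr t"
  have D: "0 < D" using C_ge_1 by (simp add: D_def)
  define K where "K = 48 * pi * D powr p / c"
  have "\<phi> (cmod z) powr p * (1 - cmod z) * cmod (f z) powr p \<le> K * M"
    if f: "f holomorphic_on disk" and M: "0 \<le> M" "Hpp_integral p \<phi> f \<le> ennreal M"
      and z: "1 / 2 \<le> cmod z" "cmod z < 1" for f M z
  proof -
    define a where "a = cmod z"
    have a: "1 / 2 \<le> a" "a < 1" using z by (auto simp: a_def)
    define \<delta> where "\<delta> = (1 - a) / 2"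
    have \<delta>: "0 < \<delta>" "a + \<delta> < 1" using a by (auto simp: \<delta>_def field_simps)
    obtain d \<alpha> where d: "0 < d" "0 \<le> \<alpha>" "a - \<delta> \<le> \<alpha>" "\<alpha> + d \<le> a + \<delta>"
      and I: "\<And>r. r \<in> {\<alpha>..\<alpha> + d} \<Longrightarrow> c * \<delta>\<^sup>2 * cmod (f z) powr p
            \<le> d * integral {0..2 * pi} (\<lambda>\<theta>. cmod (f (of_real r * cis \<theta>)) powr p)"
      using c(2)[OF f \<delta>(1), of z] \<delta>(2) unfolding a_def by blast
    define W where "W = \<phi> a powr p / D powr p / (6 * (1 - a))"
    have \<phi>a: "0 < \<phi> a" using a by (intro pos) auto
    have W: "0 \<le> W" using a \<phi>a by (simp add: W_def)
    define X where "X = c * \<delta>\<^sup>2 * cmod (f z) powr p / d / (2 * pi) * W"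
    have "X * d \<le> M"
    proof (rule const_le_Hpp_integral[OF _ _ _ _ M])
      show "0 \<le> \<alpha>" "0 \<le> d" "\<alpha> + d < 1" using d \<delta> by auto
      show "0 \<le> X" unfolding X_def using W c d by simp
      fix r assume r: "\<alpha> \<le> r" "r \<le> \<alpha> + d"
      have ra: "1 / 4 \<le> r" "r \<le> (1 + a) / 2" "1 - r \<le> 3 * (1 - a) / 2"
        using r d a by (auto simp: \<delta>_def field_simps)
      have r1: "r < 1" using ra a by auto
      have "\<phi> a \<le> D * \<phi> r" unfolding D_def using ra a by (intro local_comparison) auto
      then have "\<phi> a powr p \<le> (D * \<phi> r) powr p" using \<phi>a p by (intro powr_mono2) auto
      also have "\<dots> = D powr p * \<phi> r powr p" by (rule powr_mult)
      finally have 1: "\<phi> a powr p / D powr p \<le> \<phi> r powr p" using D by (simp add: field_simps)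
      have "W = (\<phi> a powr p / D powr p) / (3 * (1 - a) / 2) * (1 / 4)"
        by (simp add: W_def field_simps)
      also have "\<dots> \<le> \<phi> r powr p / (1 - r) * r"
        using 1 ra r1 a by (intro mult_mono frac_le) auto
      finally have W_le: "W \<le> \<phi> r powr p / (1 - r) * r" .
      have "c * \<delta>\<^sup>2 * cmod (f z) powr p / d / (2 * pi) \<le> integral_mean p f r powr p"
        using I[of r] r d ra r1 p f
        by (subst integral_mean_powr) (auto simp: field_simps)
      then have "X \<le> integral_mean p f r powr p * (\<phi> r powr p / (1 - r) * r)"
        unfolding X_def using W_le W by (intro mult_mono) auto
      then show "X \<le> integral_mean p f r powr p * (\<phi> r powr p / (1 - r)) * r"
        by (simp add: mult.assoc)
    qed
    moreover have "X * d = (\<phi> a powr p * (1 - a) * cmod (f z) powr p) * (c / (48 * pi * D powr p))"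
      using a d D by (simp add: X_def W_def \<delta>_def power2_eq_square field_simps)
    ultimately show ?thesis
      using c D unfolding K_def a_def by (simp add: field_simps)
  qed
  moreover have "0 < K" using c D by (simp add: K_def)
  ultimately show thesis using that by blast
qed

text \<open>
  Near the origin the estimate follows from the one on the circle of radius 1/2 by the maximum principle.
\<close>

lemma powr_growth_estimate:
  assumes p: "0 < p"
  obtains K where "0 < K"
    "\<And>f M z. f holomorphic_on disk \<Longrightarrow> 0 \<le> M \<Longrightarrow> Hpp_integral p \<phi> f \<le> ennreal M \<Longrightarrow>
       z \<in> disk \<Longrightarrow> \<phi> (cmod z) powr p * (1 - cmod z) * cmod (f z) powr p \<le> K * M"
proof -
  obtain K where K: "0 < K"
    "\<And>f M z. f holomorphic_on disk \<Longrightarrow> 0 \<le> M \<Longrightarrow> Hpp_integral p \<phi> f \<le> ennreal M \<Longrightarrow>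
       1 / 2 \<le> cmod z \<Longrightarrow> cmod z < 1 \<Longrightarrow> \<phi> (cmod z) powr p * (1 - cmod z) * cmod (f z) powr p \<le> K * M"
    by (rule powr_growth_estimate_outer[OF p]) blast
  define D where "D = C * 2 powr t"
  have "1 \<le> (2::real) powr t" using t_pos by (simp add: ge_one_powr_ge_zero)
  then have D: "1 \<le> D" using C_ge_1 mult_mono[of 1 C 1 "2 powr t"] by (simp add: D_def)
  have Dp: "1 \<le> D powr p" using D p by (simp add: ge_one_powr_ge_zero)
  define K' where "K' = 2 * D powr p * K"
  have KK: "K \<le> K'" using mult_right_mono[of 1 "2 * D powr p" K] K Dp by (auto simp: K'_def)
  have "\<phi> (cmod z) powr p * (1 - cmod z) * cmod (f z) powr p \<le> K' * M"
    if f: "f holomorphic_on disk" and M: "0 \<le> M" "Hpp_integral p \<phi> f \<le> ennreal M"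
      and z: "z \<in> disk" for f M z
  proof (cases "1 / 2 \<le> cmod z")
    case True
    then have "\<phi> (cmod z) powr p * (1 - cmod z) * cmod (f z) powr p \<le> K * M"
      using f M z by (intro K(2)) auto
    also have "\<dots> \<le> K' * M" using KK M by (intro mult_right_mono)
    finally show ?thesis .
  next
    case False
    have ph: "0 < \<phi> (1 / 2)" "0 < \<phi> (cmod z)" using False by (auto intro!: pos)
    define B where "B = (2 * K * M / \<phi> (1 / 2) powr p) powr (1 / p)"
    have "cmod (f z) \<le> B"
    proof (rule maximum_modulus_frontier[of f "cball 0 (1 / 2)"])
      show "f holomorphic_on interior (cball 0 (1 / 2))"
        by (rule holomorphic_on_subset[OF f]) auto
      show "continuous_on (closure (cball 0 (1 / 2))) f"
        by (rule continuous_on_subset[OF holomorphic_on_imp_continuous_on[OF f]]) auto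
      show "z \<in> cball 0 (1 / 2)" using False by auto
      fix w :: complex assume "w \<in> frontier (cball 0 (1 / 2))"
      then have w: "cmod w = 1 / 2" by simp
      have "cmod (f w) powr p \<le> 2 * K * M / \<phi> (1 / 2) powr p"
        using K(2)[OF f M, of w] w ph by (simp add: field_simps)
      then have "(cmod (f w) powr p) powr (1 / p) \<le> B"
        unfolding B_def using p by (intro powr_mono2) auto
      then show "cmod (f w) \<le> B" using p by (simp add: powr_powr)
    qed auto
    then have "cmod (f z) powr p \<le> B powr p" using p by (intro powr_mono2) auto
    also have "\<dots> = 2 * K * M / \<phi> (1 / 2) powr p"
      unfolding B_def using p K M ph by (simp add: powr_powr)
    finally have 1: "cmod (f z) powr p \<le> 2 * K * M / \<phi> (1 / 2) powr p" .
    have "\<phi> (cmod z) \<le> D * \<phi> (1 / 2)" unfolding D_def using False by (intro local_comparison) auto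
    then have "\<phi> (cmod z) powr p \<le> (D * \<phi> (1 / 2)) powr p" using ph p by (intro powr_mono2) auto
    then have "\<phi> (cmod z) powr p * (1 - cmod z) \<le> D powr p * \<phi> (1 / 2) powr p * 1"
      using z by (intro mult_mono) (auto simp: powr_mult)
    then have 2: "\<phi> (cmod z) powr p * (1 - cmod z) \<le> D powr p * \<phi> (1 / 2) powr p" by simp
    have "\<phi> (cmod z) powr p * (1 - cmod z) * cmod (f z) powr p
        \<le> D powr p * \<phi> (1 / 2) powr p * (2 * K * M / \<phi> (1 / 2) powr p)"
      by (rule mult_mono[OF 2 1]) auto
    also have "\<dots> = K' * M" using ph by (simp add: K'_def)
    finally show ?thesis .
  qed
  moreover have "0 < K'" using K KK by linarith
  ultimately show thesis using that by blast
qed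

lemma growth_estimate:
  assumes p: "0 < p"
  obtains K where "0 < K"
    "\<And>f M. f \<in> Hpp p \<phi> \<Longrightarrow> Hpp_norm p \<phi> f \<le> M \<Longrightarrow> growth_bounded p \<phi> (K * M) f"
proof -
  obtain K where K: "0 < K"
    "\<And>f M z. f holomorphic_on disk \<Longrightarrow> 0 \<le> M \<Longrightarrow> Hpp_integral p \<phi> f \<le> ennreal M \<Longrightarrow>
       z \<in> disk \<Longrightarrow> \<phi> (cmod z) powr p * (1 - cmod z) * cmod (f z) powr p \<le> K * M"
    by (rule powr_growth_estimate[OF p]) blast
  have "growth_bounded p \<phi> ((2 * K) powr (1 / p) * M) f"
    if f: "f \<in> Hpp p \<phi>" and M: "Hpp_norm p \<phi> f \<le> M" for f M
    unfolding growth_bounded_def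
  proof
    fix z :: complex assume z: "z \<in> disk"
    define J where "J = enn2real (Hpp_integral p \<phi> f)"
    have J0: "0 \<le> J" by (simp add: J_def)
    have hol: "f holomorphic_on disk" using f by (simp add: Hpp_def hol_disk_def)
    have "Hpp_integral p \<phi> f < top" using f by (simp add: Hpp_def)
    then have "Hpp_integral p \<phi> f \<le> ennreal J" by (simp add: J_def ennreal_enn2real)
    from K(2)[OF hol J0 this z]
    have 1: "\<phi> (cmod z) powr p * (1 - cmod z) * cmod (f z) powr p \<le> K * J" .
    have ph: "0 < \<phi> (cmod z)" using z by (intro pos) auto
    have "(1 - (cmod z)\<^sup>2) = (1 + cmod z) * (1 - cmod z)" by (simp add: power2_eq_square algebra_simps)
    also have "\<dots> \<le> 2 * (1 - cmod z)" using z by (intro mult_right_mono) auto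
    finally have "(\<phi> (cmod z) powr p * cmod (f z) powr p) * (1 - (cmod z)\<^sup>2)
        \<le> (\<phi> (cmod z) powr p * cmod (f z) powr p) * (2 * (1 - cmod z))"
      by (intro mult_left_mono) auto
    also have "\<dots> = 2 * (\<phi> (cmod z) powr p * (1 - cmod z) * cmod (f z) powr p)" by (simp add: mult_ac)
    also have "\<dots> \<le> 2 * (K * J)" using 1 by (intro mult_left_mono) auto
    also have "\<dots> = 2 * K * J" by simp
    finally have "((\<phi> (cmod z) powr p * cmod (f z) powr p) * (1 - (cmod z)\<^sup>2)) powr (1 / p)
        \<le> (2 * K * J) powr (1 / p)"
      using p disk_weight_nonneg[OF z] by (intro powr_mono2) auto
    also have "((\<phi> (cmod z) powr p * cmod (f z) powr p) * (1 - (cmod z)\<^sup>2)) powr (1 / p)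
        = cmod (f z) * (\<phi> (cmod z) * (1 - (cmod z)\<^sup>2) powr (1 / p))"
      using p ph by (simp add: powr_mult powr_powr mult_ac)
    also have "(2 * K * J) powr (1 / p) = (2 * K) powr (1 / p) * Hpp_norm p \<phi> f"
      by (simp add: powr_mult Hpp_norm_def J_def)
    also have "\<dots> \<le> (2 * K) powr (1 / p) * M" using M by (intro mult_left_mono) auto
    finally show "cmod (f z) * (\<phi> (cmod z) * (1 - (cmod z)\<^sup>2) powr (1 / p)) \<le> (2 * K) powr (1 / p) * M" .
  qed
  moreover have "0 < (2 * K) powr (1 / p)" using K by simp
  ultimately show thesis using that by blast
qed

text \<open>
  Cauchy's inequality on the disk of radius \<open>(1 - |z|) / 2\<close> around \<open>z\<close>. The hypothesis is the growth bound
  and not a norm bound, so that the estimate also applies to locally uniform limits.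
\<close>

lemma deriv_growth_estimate:
  assumes p: "0 < p"
  obtains K where "0 < K"
    "\<And>f A z. f holomorphic_on disk \<Longrightarrow> growth_bounded p \<phi> A f \<Longrightarrow> z \<in> disk \<Longrightarrow>
       cmod (deriv f z) * (\<phi> (cmod z) * (1 - (cmod z)\<^sup>2) powr (1 + 1 / p)) \<le> K * A"
proof -
  define D where "D = C * 2 powr t"
  have D: "0 < D" using C_ge_1 by (simp add: D_def)
  define K where "K = 4 * (D * 4 powr (1 / p))"
  have "cmod (deriv f z) * (\<phi> (cmod z) * (1 - (cmod z)\<^sup>2) powr (1 + 1 / p)) \<le> K * A"
    if f: "f holomorphic_on disk" and g: "growth_bounded p \<phi> A f" and z: "z \<in> disk" for f A z
  proof -
    define a where "a = cmod z"
    have a: "0 \<le> a" "a < 1" using z by (auto simp: a_def)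
    define \<delta> where "\<delta> = (1 - a) / 2"
    have \<delta>: "0 < \<delta>" "a + \<delta> < 1" using a by (auto simp: \<delta>_def field_simps)
    have in_disk: "cmod w \<le> a + \<delta>" if "cmod (z - w) \<le> \<delta>" for w
      using norm_triangle_ineq4[of z "z - w"] that by (simp add: a_def)
    have sub: "cball z \<delta> \<subseteq> disk" using in_disk \<delta> by (fastforce simp: dist_norm)
    have sq: "1 - a\<^sup>2 \<le> 2 * (1 - a)" "0 < 1 - a\<^sup>2"
    proof -
      have e: "1 - a\<^sup>2 = (1 + a) * (1 - a)" by (simp add: power2_eq_square algebra_simps)
      show "1 - a\<^sup>2 \<le> 2 * (1 - a)" unfolding e using a by (intro mult_right_mono) auto
      show "0 < 1 - a\<^sup>2" unfolding e using a by (intro mult_pos_pos) auto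
    qed
    define V where "V = \<phi> a * (1 - a\<^sup>2) powr (1 / p)"
    have \<phi>a: "0 < \<phi> a" using a by (intro pos) auto
    have V: "0 < V" using \<phi>a sq by (simp add: V_def)
    have "cmod ((deriv ^^ 1) f z) \<le> fact 1 * (D * 4 powr (1 / p) * A / V) / \<delta> ^ 1"
    proof (rule Cauchy_inequality[OF _ _ \<delta>(1)])
      show "f holomorphic_on ball z \<delta>"
        by (rule holomorphic_on_subset[OF f]) (use sub ball_subset_cball in blast)
      show "continuous_on (cball z \<delta>) f"
        by (rule continuous_on_subset[OF holomorphic_on_imp_continuous_on[OF f] sub])
      fix w assume w: "cmod (z - w) = \<delta>"
      define b where "b = cmod w"
      have b: "0 \<le> b" "b \<le> (1 + a) / 2" "b < 1" using in_disk[of w] w \<delta> by (auto simp: b_def \<delta>_def field_simps)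
      have 1: "\<phi> a \<le> D * \<phi> b" unfolding D_def using a b by (intro local_comparison) auto
      have "1 - a\<^sup>2 \<le> 4 * (1 - b)" using sq b by (simp add: field_simps)
      also have "\<dots> \<le> 4 * (1 - b\<^sup>2)" using b by (simp add: power2_eq_square mult_left_le)
      finally have "(1 - a\<^sup>2) powr (1 / p) \<le> (4 * (1 - b\<^sup>2)) powr (1 / p)"
        using p sq by (intro powr_mono2) auto
      also have "\<dots> = 4 powr (1 / p) * (1 - b\<^sup>2) powr (1 / p)" by (rule powr_mult)
      finally have "V \<le> (D * \<phi> b) * (4 powr (1 / p) * (1 - b\<^sup>2) powr (1 / p))"
        unfolding V_def using 1 \<phi>a by (intro mult_mono) auto
      then have "cmod (f w) * V \<le> cmod (f w) * ((D * \<phi> b) * (4 powr (1 / p) * (1 - b\<^sup>2) powr (1 / p)))"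
        by (intro mult_left_mono) auto
      also have "\<dots> = (D * 4 powr (1 / p)) * (cmod (f w) * (\<phi> b * (1 - b\<^sup>2) powr (1 / p)))"
        by (simp add: mult_ac)
      also have "\<dots> \<le> (D * 4 powr (1 / p)) * A"
        using g b D unfolding growth_bounded_def b_def by (intro mult_left_mono) auto
      finally show "cmod (f w) \<le> D * 4 powr (1 / p) * A / V" using V by (simp add: field_simps)
    qed
    then have 1: "cmod (deriv f z) * V \<le> D * 4 powr (1 / p) * A / \<delta>"
      using V \<delta>(1) by (simp add: field_simps)
    have "cmod (deriv f z) * (\<phi> a * (1 - a\<^sup>2) powr (1 + 1 / p)) = (cmod (deriv f z) * V) * (1 - a\<^sup>2)"
      using sq by (simp add: V_def powr_add)
    also have "\<dots> \<le> (D * 4 powr (1 / p) * A / \<delta>) * (1 - a\<^sup>2)"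
      using 1 sq by (intro mult_right_mono) auto
    also have "\<dots> \<le> (D * 4 powr (1 / p) * A / \<delta>) * (2 * (1 - a))"
    proof -
      have "0 \<le> D * 4 powr (1 / p) * A / \<delta>"
        using 1 V by (meson mult_nonneg_nonneg norm_ge_zero order_trans less_imp_le)
      then show ?thesis using sq by (intro mult_left_mono)
    qed
    also have "\<dots> = K * A" using a by (simp add: K_def \<delta>_def field_simps)
    finally show ?thesis by (simp add: a_def)
  qed
  moreover have "0 < K" using D by (simp add: K_def)
  ultimately show thesis using that by blast
qed

lemma growth_bounded_nonneg:
  assumes "growth_bounded p \<phi> A f"
  shows "0 \<le> A"
proof -
  have "0 \<le> cmod (f 0) * (\<phi> (cmod 0) * (1 - (cmod 0)\<^sup>2) powr (1 / p))"
    using pos[of 0] by simp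
  also have "\<dots> \<le> A" using assms unfolding growth_bounded_def by (rule bspec) simp
  finally show ?thesis .
qed

text \<open>
  The local boundedness that Montel's theorem asks for.
\<close>

lemma growth_bounded_locally_bounded:
  assumes p: "0 < p" and K: "compact K" "K \<subseteq> disk"
  shows "\<exists>B. \<forall>h\<in>{h. h holomorphic_on disk \<and> growth_bounded p \<phi> A h}. \<forall>z\<in>K. cmod (h z) \<le> B"
proof -
  obtain \<rho> where \<rho>: "0 \<le> \<rho>" "\<rho> < 1" "\<And>z. z \<in> K \<Longrightarrow> cmod z \<le> \<rho>"
    by (rule compact_subset_disk[OF K]) blast
  define V where "V = \<phi> \<rho> / C * (1 - \<rho>\<^sup>2) powr (1 / p)"
  have "0 < 1 - \<rho>\<^sup>2" using \<rho> by (simp add: power_less_one_iff abs_square_less_1)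
  then have V: "0 < V" using pos[OF \<rho>(1,2)] C_ge_1 by (simp add: V_def)
  have "cmod (h z) \<le> A / V" if h: "growth_bounded p \<phi> A h" and z: "z \<in> K" for h z
  proof -
    have z1: "cmod z \<le> \<rho>" "z \<in> disk" using \<rho>(3)[OF z] z K by auto
    have \<phi>z: "0 < \<phi> (cmod z)" using z1 by (intro pos) auto
    have "\<phi> \<rho> \<le> C * \<phi> (cmod z) * ((1 - \<rho>) / (1 - cmod z)) powr s"
      using z1 \<rho> by (intro upper) auto
    also have "\<dots> \<le> C * \<phi> (cmod z) * 1 powr s"
      using z1 \<rho> s_pos \<phi>z C_ge_1 by (intro mult_left_mono powr_mono2) (auto simp: divide_le_eq)
    finally have "\<phi> \<rho> / C \<le> \<phi> (cmod z)" using C_ge_1 by (simp add: divide_le_eq mult.commute)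
    moreover have "(1 - \<rho>\<^sup>2) powr (1 / p) \<le> (1 - (cmod z)\<^sup>2) powr (1 / p)"
      using z1 \<rho> p by (intro powr_mono2) (auto simp: power_le_one power_mono)
    ultimately have "V \<le> \<phi> (cmod z) * (1 - (cmod z)\<^sup>2) powr (1 / p)"
      unfolding V_def using \<phi>z by (intro mult_mono) auto
    then have "cmod (h z) * V \<le> cmod (h z) * (\<phi> (cmod z) * (1 - (cmod z)\<^sup>2) powr (1 / p))"
      by (intro mult_left_mono) auto
    also have "\<dots> \<le> A" using h z1(2) by (simp add: growth_bounded_def)
    finally show ?thesis using V by (simp add: le_divide_eq)
  qed
  then show ?thesis by blast
qed

lemma growth_bounded_diff:
  assumes "growth_bounded p \<phi> A f" "growth_bounded p \<phi> B g"
  shows "growth_bounded p \<phi> (A + B) (\<lambda>z. f z - g z)"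
  unfolding growth_bounded_def
proof
  fix z :: complex assume z: "z \<in> disk"
  define V where "V = \<phi> (cmod z) * (1 - (cmod z)\<^sup>2) powr (1 / p)"
  have "0 < \<phi> (cmod z)" using z by (intro pos) auto
  then have "0 \<le> V" by (simp add: V_def)
  then have "cmod (f z - g z) * V \<le> (cmod (f z) + cmod (g z)) * V"
    by (intro mult_right_mono norm_triangle_ineq4)
  also have "\<dots> \<le> A + B"
    using assms z unfolding growth_bounded_def V_def[symmetric] distrib_right by (intro add_mono) (auto simp: V_def)
  finally show "cmod (f z - g z) * (\<phi> (cmod z) * (1 - (cmod z)\<^sup>2) powr (1 / p)) \<le> A + B"
    by (simp add: V_def)
qed

end

section \<open>Test functions\<close>

text \<open>
  On the unit circle \<open>|1 - a u|\<^sup>2 = (1 - a u) (u - cnj a) / u\<close>, so Cauchy's formula for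
  \<open>1 / (1 - a u)\<close> at the point \<open>cnj a\<close> evaluates the integral.
\<close>

lemma has_integral_Poisson_kernel:
  assumes a: "cmod a < 1"
  shows "((\<lambda>\<theta>. 1 / (cmod (1 - a * cis \<theta>))\<^sup>2) has_integral 2 * pi / (1 - (cmod a)\<^sup>2)) {0..2 * pi}"
proof -
  have nz: "1 - a * u \<noteq> 0" if "cmod u \<le> 1" for u
  proof
    assume "1 - a * u = 0"
    then have "cmod a * cmod u = 1" by (simp flip: norm_mult)
    moreover have "cmod a * cmod u \<le> cmod a * 1" using that by (intro mult_left_mono) auto
    ultimately show False using a by simp
  qed
  have "(\<lambda>u. 1 / (1 - a * u)) holomorphic_on cball 0 1"
    using nz by (intro holomorphic_intros) auto
  then have "((\<lambda>u. 1 / (1 - a * u) / (u - cnj a)) has_contour_integral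
      (2 * of_real pi * \<i> * (1 / (1 - a * cnj a)))) (circlepath 0 1)"
    using a by (intro Cauchy_integral_circlepath_simple) auto
  then have "((\<lambda>\<theta>. 1 / (1 - a * (0 + of_real 1 * cis \<theta>)) / (0 + of_real 1 * cis \<theta> - cnj a) * of_real 1 * \<i> * cis \<theta>)
      has_integral (2 * of_real pi * \<i> * (1 / (1 - a * cnj a)))) {0..2 * pi}"
    unfolding circlepath_def by (subst (asm) has_contour_integral_part_circlepath_iff) auto
  from has_integral_mult_right[OF this, of "- \<i>"]
  have "((\<lambda>\<theta>. 1 / (1 - a * cis \<theta>) / (cis \<theta> - cnj a) * cis \<theta>)
      has_integral (2 * of_real pi / (1 - a * cnj a))) {0..2 * pi}"
    by (simp add: mult_ac)
  moreover have "1 / (1 - a * cis \<theta>) / (cis \<theta> - cnj a) * cis \<theta> = of_real (1 / (cmod (1 - a * cis \<theta>))\<^sup>2)" for \<theta>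
  proof -
    have "cis \<theta> * cnj (cis \<theta>) = 1" by (simp add: complex_norm_square[symmetric])
    then have e: "cis \<theta> - cnj a = cis \<theta> * cnj (1 - a * cis \<theta>)"
      by (simp add: algebra_simps)
    have "1 / (1 - a * cis \<theta>) / (cis \<theta> - cnj a) * cis \<theta> = 1 / ((1 - a * cis \<theta>) * cnj (1 - a * cis \<theta>))"
      unfolding e by simp
    also have "\<dots> = of_real (1 / (cmod (1 - a * cis \<theta>))\<^sup>2)"
      unfolding complex_norm_square[symmetric] by simp
    finally show ?thesis .
  qed
  ultimately have "((\<lambda>\<theta>. of_real (1 / (cmod (1 - a * cis \<theta>))\<^sup>2))
      has_integral (2 * of_real pi / (1 - a * cnj a) :: complex)) {0..2 * pi}" by simp
  from has_integral_Re[OF this]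
  have "((\<lambda>\<theta>. 1 / (cmod (1 - a * cis \<theta>))\<^sup>2) has_integral Re (2 * of_real pi / (1 - a * cnj a))) {0..2 * pi}"
    by (simp only: Re_complex_of_real)
  also have "2 * of_real pi / (1 - a * cnj a) = complex_of_real (2 * pi / (1 - (cmod a)\<^sup>2))"
    unfolding complex_norm_square[symmetric] by simp
  finally show ?thesis by (simp only: Re_complex_of_real)
qed

text \<open>
  For \<open>0 < q < 1\<close> and \<open>c = 1\<close> the integrand is singular at the end point, but its primitive is continuous there.
\<close>

lemma has_integral_one_minus_powr:
  fixes q b c :: real
  assumes "q \<noteq> 0" "b \<le> c" "c \<le> 1" "c < 1 \<or> 0 < q"
  shows "((\<lambda>r. (1 - r) powr (q - 1)) has_integral ((1 - b) powr q - (1 - c) powr q) / q) {b..c}"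
proof -
  have "((\<lambda>r. (1 - r) powr (q - 1)) has_integral (- ((1 - c) powr q / q) - - ((1 - b) powr q / q))) {b..c}"
  proof (rule fundamental_theorem_of_calculus_interior[OF assms(2)])
    show "continuous_on {b..c} (\<lambda>r. - ((1 - r) powr q / q))"
    proof (cases "c < 1")
      case True
      then show ?thesis by (intro continuous_intros) (use assms in auto)
    next
      case False
      then show ?thesis by (intro continuous_intros continuous_on_powr') (use assms in auto)
    qed
    fix r assume "r \<in> {b<..<c}"
    then have "r < 1" using assms by auto
    then have "((\<lambda>r. - ((1 - r) powr q / q)) has_real_derivative (1 - r) powr (q - 1)) (at r)"
      using assms by (auto intro!: derivative_eq_intros)
    then show "((\<lambda>r. - ((1 - r) powr q / q)) has_vector_derivative (1 - r) powr (q - 1)) (at r)"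
      by (simp add: has_real_derivative_iff_has_vector_derivative)
  qed
  then show ?thesis by (simp add: diff_divide_distrib)
qed

text \<open>
  All but two of the \<open>N p\<close> powers of the kernel are bounded by its maximum, and the remaining square
  is the Poisson kernel; for this \<open>N p \<ge> 2\<close> is required.
\<close>

lemma circle_integral_le_of_kernel_bound:
  assumes g: "g holomorphic_on disk" and p: "0 < p" and N: "2 \<le> real N * p"
    and w: "w \<in> disk" and r: "0 \<le> r" "r < 1" and A: "0 \<le> A"
    and le: "\<And>z. z \<in> disk \<Longrightarrow> cmod (g z) \<le> A / cmod (1 - cnj w * z) ^ N"
  shows "integral {0..2 * pi} (\<lambda>\<theta>. cmod (g (of_real r * cis \<theta>)) powr p)
    \<le> 2 * pi * (A powr p * (1 - r * cmod w) powr (1 - real N * p))"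
proof -
  define b where "b = r * cmod w"
  have b: "0 \<le> b" "b < 1" using r w mult_strict_mono'[of r 1 "cmod w" 1] by (auto simp: b_def)
  have cb: "cmod (cnj w * of_real r) = b" using r by (simp add: b_def norm_mult mult.commute)
  have P: "((\<lambda>\<theta>. 1 / (cmod (1 - (cnj w * of_real r) * cis \<theta>))\<^sup>2) has_integral 2 * pi / (1 - b\<^sup>2)) {0..2 * pi}"
    using has_integral_Poisson_kernel[of "cnj w * of_real r"] b unfolding cb by simp
  define E where "E = A powr p * (1 - b) powr (2 - real N * p)"
  have E: "0 \<le> E" by (simp add: E_def)
  have "integral {0..2 * pi} (\<lambda>\<theta>. cmod (g (of_real r * cis \<theta>)) powr p)
      \<le> integral {0..2 * pi} (\<lambda>\<theta>. E * (1 / (cmod (1 - (cnj w * of_real r) * cis \<theta>))\<^sup>2))"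
  proof (rule integral_le)
    show "(\<lambda>\<theta>. cmod (g (of_real r * cis \<theta>)) powr p) integrable_on {0..2 * pi}"
      using g r p by (intro integrable_continuous_interval continuous_on_circle_powr)
    show "(\<lambda>\<theta>. E * (1 / (cmod (1 - (cnj w * of_real r) * cis \<theta>))\<^sup>2)) integrable_on {0..2 * pi}"
      using has_integral_mult_right[OF P, of E] by (rule has_integral_integrable)
    fix \<theta> :: real
    define d where "d = cmod (1 - (cnj w * of_real r) * cis \<theta>)"
    have d: "1 - b \<le> d"
      using norm_triangle_ineq2[of 1 "(cnj w * of_real r) * cis \<theta>"] cb
      by (simp add: d_def norm_mult)
    have d0: "0 < d" using d b by linarith
    have "cmod (g (of_real r * cis \<theta>)) \<le> A / d ^ N"
      using le[of "of_real r * cis \<theta>"] r by (simp add: d_def norm_mult mult.assoc)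
    then have "cmod (g (of_real r * cis \<theta>)) powr p \<le> (A / d ^ N) powr p"
      using p by (intro powr_mono2) auto
    also have "\<dots> = A powr p * d powr (- (real N * p))"
      using A d0 by (simp add: powr_divide powr_minus_divide powr_powr flip: powr_realpow)
    also have "d powr (- (real N * p)) = d powr (2 - real N * p) * (1 / d\<^sup>2)"
      using d0 by (simp add: powr_diff powr_minus_divide)
    also have "A powr p * (d powr (2 - real N * p) * (1 / d\<^sup>2))
        \<le> A powr p * ((1 - b) powr (2 - real N * p) * (1 / d\<^sup>2))"
      using d b N by (intro mult_left_mono mult_right_mono powr_mono2') auto
    finally show "cmod (g (of_real r * cis \<theta>)) powr p \<le> E * (1 / (cmod (1 - (cnj w * of_real r) * cis \<theta>))\<^sup>2)"
      by (simp add: E_def d_def)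
  qed
  also have "\<dots> = E * (2 * pi / (1 - b\<^sup>2))"
    using has_integral_mult_right[OF P, of E] by (rule integral_unique)
  also have "\<dots> \<le> E * (2 * pi / (1 - b))"
  proof -
    have "1 - b \<le> 1 - b\<^sup>2" using b by (simp add: power2_eq_square mult_left_le)
    then show ?thesis using b E by (intro mult_left_mono divide_left_mono mult_pos_pos) auto
  qed
  also have "\<dots> = 2 * pi * (A powr p * ((1 - b) powr (2 - real N * p) / (1 - b)))"
    by (simp add: E_def)
  also have "(1 - b) powr (2 - real N * p) / (1 - b) = (1 - b) powr (1 - real N * p)"
    using b by (simp add: powr_diff power2_eq_square)
  finally show ?thesis by (simp add: b_def)
qed

context growth_weight
begin

text \<open>
  With \<open>b = |w|\<close>, the factor \<open>1 - r b\<close> is at least \<open>1 - r\<close> and at least \<open>1 - b\<close>. The first bound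
  together with \<open>\<phi> r \<le> C \<phi> b ((1 - r) / (1 - b)) powr t\<close> serves for \<open>r \<le> b\<close>, the second together
  with the same inequality for the exponent \<open>s\<close> serves for \<open>r \<ge> b\<close>. The powers of \<open>1 - b\<close> are such
  that the integrals over \<open>[0, b]\<close> and \<open>[b, 1]\<close> are bounded independently of \<open>b\<close> once \<open>c > t p\<close>.
\<close>

lemma test_function_integrand_bound:
  assumes p: "0 < p" and N: "2 \<le> real N * p" and K: "0 \<le> K" and w: "w \<in> disk"
    and g: "g holomorphic_on disk"
    and le: "\<And>z. z \<in> disk \<Longrightarrow> cmod (g z) \<le> K * (1 - (cmod w)\<^sup>2) powr (real N - 1 / p) / \<phi> (cmod w) / cmod (1 - cnj w * z) ^ N"
    and r: "0 \<le> r" "r < 1"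
    and c_def: "c = real N * p - 1" and G_def: "G = K powr p * 2 powr c * C powr p"
  shows "r \<le> cmod w \<Longrightarrow> integral_mean p g r powr p * (\<phi> r powr p / (1 - r)) * r
      \<le> G * (1 - cmod w) powr (c - t * p) * (1 - r) powr (- (c - t * p) - 1)"
    and "cmod w \<le> r \<Longrightarrow> integral_mean p g r powr p * (\<phi> r powr p / (1 - r)) * r
      \<le> G * (1 - cmod w) powr (- (s * p)) * (1 - r) powr (s * p - 1)"
proof -
  define b where "b = cmod w"
  have b: "0 \<le> b" "b < 1" using w by (auto simp: b_def)
  have c: "1 \<le> c" using N by (simp add: c_def)
  have ph: "0 < \<phi> r" "0 < \<phi> b" using r b pos by auto
  have b2: "0 \<le> 1 - b\<^sup>2" "1 - b\<^sup>2 \<le> 2 * (1 - b)"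
  proof -
    have e: "1 - b\<^sup>2 = (1 + b) * (1 - b)" by (simp add: power2_eq_square algebra_simps)
    show "1 - b\<^sup>2 \<le> 2 * (1 - b)" unfolding e using b by (intro mult_right_mono) auto
    show "0 \<le> 1 - b\<^sup>2" unfolding e using b by (intro mult_nonneg_nonneg) auto
  qed
  have rb: "r * b \<le> r" "r * b \<le> b" using r b by (auto simp: mult_left_le mult_left_le_one_le)
  define A where "A = K * (1 - b\<^sup>2) powr (real N - 1 / p) / \<phi> b"
  have A: "0 \<le> A" using K ph by (simp add: A_def)
  have "A powr p = K powr p * (1 - b\<^sup>2) powr c / \<phi> b powr p"
    using K ph p by (simp add: A_def powr_divide powr_mult powr_powr c_def algebra_simps)
  also have "\<dots> \<le> K powr p * (2 * (1 - b)) powr c / \<phi> b powr p"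
    using b2 c by (intro divide_right_mono mult_left_mono powr_mono2) auto
  also have "\<dots> = K powr p * 2 powr c * (1 - b) powr c / \<phi> b powr p"
    unfolding powr_mult by simp
  finally have Ap: "A powr p \<le> K powr p * 2 powr c * (1 - b) powr c / \<phi> b powr p" .
  have "integral {0..2 * pi} (\<lambda>\<theta>. cmod (g (of_real r * cis \<theta>)) powr p)
      \<le> 2 * pi * (A powr p * (1 - r * b) powr (1 - real N * p))"
    unfolding b_def using le
    by (intro circle_integral_le_of_kernel_bound g p N w r A) (simp add: A_def b_def)
  then have "integral_mean p g r powr p \<le> A powr p * (1 - r * b) powr (- c)"
    unfolding integral_mean_powr[OF g r p] c_def by (simp add: divide_le_eq mult_ac)
  also have "\<dots> \<le> (K powr p * 2 powr c * (1 - b) powr c / \<phi> b powr p) * (1 - r * b) powr (- c)"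
    using Ap by (intro mult_right_mono) auto
  finally have im: "integral_mean p g r powr p
      \<le> (K powr p * 2 powr c * (1 - b) powr c / \<phi> b powr p) * (1 - r * b) powr (- c)" .
  have main: "integral_mean p g r powr p * (\<phi> r powr p / (1 - r)) * r
      \<le> (K powr p * 2 powr c * (1 - b) powr c / \<phi> b powr p) * B * (C powr p * \<phi> b powr p * L / (1 - r))"
    if B: "(1 - r * b) powr (- c) \<le> B" and L: "\<phi> r powr p \<le> C powr p * \<phi> b powr p * L" for B L
  proof -
    have B0: "0 \<le> B" using B by (rule order_trans[rotated]) simp
    have "integral_mean p g r powr p * (\<phi> r powr p / (1 - r)) * r
        \<le> integral_mean p g r powr p * (\<phi> r powr p / (1 - r)) * 1"
      using r by (intro mult_left_mono) auto
    also have "\<dots> \<le> (K powr p * 2 powr c * (1 - b) powr c / \<phi> b powr p * B) * (C powr p * \<phi> b powr p * L / (1 - r))"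
      unfolding mult_1_right
    proof (rule mult_mono)
      show "integral_mean p g r powr p \<le> K powr p * 2 powr c * (1 - b) powr c / \<phi> b powr p * B"
        by (rule order_trans[OF im]) (intro mult_left_mono B, simp)
      show "\<phi> r powr p / (1 - r) \<le> C powr p * \<phi> b powr p * L / (1 - r)"
        using L r by (intro divide_right_mono) auto
    qed (use B0 r in auto)
    finally show ?thesis .
  qed
  show "integral_mean p g r powr p * (\<phi> r powr p / (1 - r)) * r
      \<le> G * (1 - cmod w) powr (c - t * p) * (1 - r) powr (- (c - t * p) - 1)" if "r \<le> cmod w"
  proof -
    have "\<phi> r powr p \<le> (C * \<phi> b * ((1 - r) / (1 - b)) powr t) powr p"
      using lower[of r b] that r b p ph by (intro powr_mono2) (auto simp: b_def)
    then have L: "\<phi> r powr p \<le> C powr p * \<phi> b powr p * ((1 - r) powr (t * p) / (1 - b) powr (t * p))"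
      using r b by (simp add: powr_mult powr_powr powr_divide)
    have B: "(1 - r * b) powr (- c) \<le> (1 - r) powr (- c)"
      using rb r c by (intro powr_mono2') auto
    have "(K powr p * 2 powr c * (1 - b) powr c / \<phi> b powr p) * (1 - r) powr (- c)
          * (C powr p * \<phi> b powr p * ((1 - r) powr (t * p) / (1 - b) powr (t * p)) / (1 - r))
        = G * ((1 - b) powr c / (1 - b) powr (t * p)) * ((1 - r) powr (- c) * (1 - r) powr (t * p) / (1 - r))"
      using ph by (simp add: G_def)
    also have "(1 - b) powr c / (1 - b) powr (t * p) = (1 - b) powr (c - t * p)"
      by (simp add: powr_diff)
    also have "(1 - r) powr (- c) * (1 - r) powr (t * p) / (1 - r) = (1 - r) powr (- c + t * p - 1)"
      using r by (simp add: powr_diff powr_add powr_minus_divide)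
    finally show ?thesis using main[OF B L] by (simp add: b_def)
  qed
  show "integral_mean p g r powr p * (\<phi> r powr p / (1 - r)) * r
      \<le> G * (1 - cmod w) powr (- (s * p)) * (1 - r) powr (s * p - 1)" if "cmod w \<le> r"
  proof -
    have "\<phi> r powr p \<le> (C * \<phi> b * ((1 - r) / (1 - b)) powr s) powr p"
      using upper[of b r] that r b p ph by (intro powr_mono2) (auto simp: b_def)
    then have L: "\<phi> r powr p \<le> C powr p * \<phi> b powr p * ((1 - r) powr (s * p) / (1 - b) powr (s * p))"
      using r b by (simp add: powr_mult powr_powr powr_divide)
    have B: "(1 - r * b) powr (- c) \<le> (1 - b) powr (- c)"
      using rb b c by (intro powr_mono2') auto
    have "(K powr p * 2 powr c * (1 - b) powr c / \<phi> b powr p) * (1 - b) powr (- c)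
          * (C powr p * \<phi> b powr p * ((1 - r) powr (s * p) / (1 - b) powr (s * p)) / (1 - r))
        = G * ((1 - b) powr c * (1 - b) powr (- c) / (1 - b) powr (s * p)) * ((1 - r) powr (s * p) / (1 - r))"
      using ph by (simp add: G_def)
    also have "(1 - b) powr c * (1 - b) powr (- c) / (1 - b) powr (s * p) = (1 - b) powr (- (s * p))"
      using b by (simp add: powr_minus_divide)
    also have "(1 - r) powr (s * p) / (1 - r) = (1 - r) powr (s * p - 1)"
      using r by (simp add: powr_diff)
    finally show ?thesis using main[OF B L] by (simp add: b_def)
  qed
qed

text \<open>
  The condition \<open>1 + t p < N p\<close> makes the exponent of \<open>1 - r\<close> in the bound for \<open>r \<le> |w|\<close> less
  than \<open>- 1\<close>, so that the integral over these radii has the size of its contribution from \<open>r\<close> near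
  \<open>|w|\<close>, which the power of \<open>1 - |w|\<close> cancels.
\<close>

lemma test_function_Hpp_bound:
  assumes p: "0 < p" and N: "2 \<le> real N * p" "1 + t * p < real N * p" and K: "0 \<le> K"
  obtains M where "0 \<le> M"
    "\<And>w g. w \<in> disk \<Longrightarrow> g holomorphic_on disk \<Longrightarrow>
       (\<And>z. z \<in> disk \<Longrightarrow> cmod (g z) \<le> K * (1 - (cmod w)\<^sup>2) powr (real N - 1 / p) / \<phi> (cmod w) / cmod (1 - cnj w * z) ^ N) \<Longrightarrow>
       Hpp_integral p \<phi> g \<le> ennreal M"
proof -
  define c where "c = real N * p - 1"
  define G where "G = K powr p * 2 powr c * C powr p"
  have G: "0 \<le> G" by (simp add: G_def)
  define e where "e = c - t * p"
  have e: "0 < e" using N by (simp add: e_def c_def)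
  have sp: "0 < s * p" using s_pos p by simp
  have "Hpp_integral p \<phi> g \<le> ennreal (G / e + G / (s * p))"
    if w: "w \<in> disk" and g: "g holomorphic_on disk" and
      le: "\<And>z. z \<in> disk \<Longrightarrow> cmod (g z) \<le> K * (1 - (cmod w)\<^sup>2) powr (real N - 1 / p) / \<phi> (cmod w) / cmod (1 - cnj w * z) ^ N"
    for w g
  proof -
    define b where "b = cmod w"
    have b: "0 \<le> b" "b < 1" using w by (auto simp: b_def)
    define F1 where "F1 = (\<lambda>r. G * (1 - b) powr e * (1 - r) powr (- e - 1))"
    define F2 where "F2 = (\<lambda>r. G * (1 - b) powr (- (s * p)) * (1 - r) powr (s * p - 1))"
    have F: "0 \<le> F1 r" "0 \<le> F2 r" for r using G by (auto simp: F1_def F2_def)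
    have [measurable]: "F1 \<in> borel_measurable borel" "F2 \<in> borel_measurable borel"
      unfolding F1_def F2_def by measurable
    have "(F1 has_integral (G * (1 - b) powr e * (((1 - 0) powr (- e) - (1 - b) powr (- e)) / (- e)))) {0..b}"
      unfolding F1_def using b e by (intro has_integral_mult_right has_integral_one_minus_powr) auto
    then have i1: "(\<integral>\<^sup>+ r. ennreal (F1 r) * indicator {0..b} r \<partial>lborel)
        = ennreal (G * (1 - b) powr e * ((1 - (1 - b) powr (- e)) / (- e)))"
      using nn_integral_has_integral_lebesgue'[of "{0..b}" F1] F by auto
    have "G * (1 - b) powr e * ((1 - (1 - b) powr (- e)) / (- e)) = G / e * (1 - (1 - b) powr e)"
      using b e by (simp add: powr_minus_divide field_simps)
    also have "\<dots> \<le> G / e * 1" using G e by (intro mult_left_mono) auto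
    finally have l1: "G * (1 - b) powr e * ((1 - (1 - b) powr (- e)) / (- e)) \<le> G / e" by simp
    have "(F2 has_integral (G * (1 - b) powr (- (s * p)) * (((1 - b) powr (s * p) - (1 - 1) powr (s * p)) / (s * p)))) {b..1}"
      unfolding F2_def using b sp by (intro has_integral_mult_right has_integral_one_minus_powr) auto
    then have i2: "(\<integral>\<^sup>+ r. ennreal (F2 r) * indicator {b..1} r \<partial>lborel)
        = ennreal (G * (1 - b) powr (- (s * p)) * ((1 - b) powr (s * p) / (s * p)))"
      using nn_integral_has_integral_lebesgue'[of "{b..1}" F2] F by auto
    have l2: "G * (1 - b) powr (- (s * p)) * ((1 - b) powr (s * p) / (s * p)) = G / (s * p)"
      using b sp by (simp add: powr_minus_divide)
    have "Hpp_integral p \<phi> g \<le> (\<integral>\<^sup>+ r. ennreal (F1 r) * indicator {0..b} r + ennreal (F2 r) * indicator {b..1} r \<partial>lborel)"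
      unfolding Hpp_integral_def
    proof (rule nn_integral_mono)
      fix r
      show "ennreal (integral_mean p g r powr p * (\<phi> r powr p / (1 - r)) * r) * indicator {0..<1} r
          \<le> ennreal (F1 r) * indicator {0..b} r + ennreal (F2 r) * indicator {b..1} r"
      proof (cases "r \<in> {0..<1}")
        case True
        then have r: "0 \<le> r" "r < 1" by auto
        note bd = test_function_integrand_bound[OF p N(1) K w g le r c_def G_def]
        show ?thesis
        proof (cases "r \<le> b")
          case True
          then have "integral_mean p g r powr p * (\<phi> r powr p / (1 - r)) * r \<le> F1 r"
            using bd(1) by (simp add: F1_def e_def b_def)
          then have "ennreal (integral_mean p g r powr p * (\<phi> r powr p / (1 - r)) * r) \<le> ennreal (F1 r)"
            by (rule ennreal_leI)
          also have "\<dots> \<le> ennreal (F1 r) + ennreal (F2 r) * indicator {b..1} r" by simp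
          finally show ?thesis using True r by simp
        next
          case False
          then have "integral_mean p g r powr p * (\<phi> r powr p / (1 - r)) * r \<le> F2 r"
            using bd(2) by (simp add: F2_def b_def)
          then show ?thesis using False r by (simp add: ennreal_leI)
        qed
      qed auto
    qed
    also have "\<dots> = ennreal (G * (1 - b) powr e * ((1 - (1 - b) powr (- e)) / (- e)))
        + ennreal (G * (1 - b) powr (- (s * p)) * ((1 - b) powr (s * p) / (s * p)))"
      by (subst nn_integral_add) (auto simp: i1 i2)
    also have "\<dots> \<le> ennreal (G / e) + ennreal (G / (s * p))"
      unfolding l2 using l1 by (intro add_mono ennreal_leI) auto
    also have "\<dots> = ennreal (G / e + G / (s * p))"
      using G e sp by (intro ennreal_plus[symmetric]) auto
    finally show ?thesis .
  qed
  moreover have "0 \<le> G / e + G / (s * p)" using G e sp by simp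
  ultimately show thesis using that by blast
qed

end

lemma has_field_derivative_inverse_power_affine:
  fixes a z :: complex
  assumes "1 - a * z \<noteq> 0"
  shows "((\<lambda>z. c / (1 - a * z) ^ n) has_field_derivative c * of_nat n * a / (1 - a * z) ^ (n + 1)) (at z)"
proof (cases n)
  case (Suc m)
  have "((\<lambda>z. inverse (1 - a * z)) has_field_derivative a * inverse (1 - a * z) ^ 2) (at z)"
    using assms by (auto intro!: derivative_eq_intros simp: power2_eq_square)
  from DERIV_cmult[OF DERIV_power[OF this, of n], of c]
  have "((\<lambda>z. c * inverse (1 - a * z) ^ n) has_field_derivative
      c * (of_nat n * (a * inverse (1 - a * z) ^ 2 * inverse (1 - a * z) ^ m))) (at z)"
    by (simp add: Suc)
  also have "c * (of_nat n * (a * inverse (1 - a * z) ^ 2 * inverse (1 - a * z) ^ m))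
      = c * of_nat n * a * inverse (1 - a * z) ^ (n + 1)"
    by (simp add: Suc power2_eq_square mult_ac)
  finally show ?thesis by (simp add: power_inverse divide_inverse)
qed auto

text \<open>
  At \<open>z = w\<close> both kernel terms, with the factor \<open>1 - |w|\<^sup>2\<close> in the second one, have size
  \<open>(1 - |w|\<^sup>2) ^ (- N)\<close>, while their logarithmic derivatives are in the ratio \<open>N\<close> to \<open>N + 1\<close>.
  Hence \<open>\<alpha>\<close> and \<open>\<beta>\<close> can be chosen to cancel either the value or the derivative at \<open>w\<close>.
\<close>

definition test_function :: "real \<Rightarrow> (real \<Rightarrow> real) \<Rightarrow> nat \<Rightarrow> real \<Rightarrow> real \<Rightarrow> complex \<Rightarrow> complex \<Rightarrow> complex" where
  "test_function p \<phi> N \<alpha> \<beta> w = (\<lambda>z\<in>disk.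
     of_real ((1 - (cmod w)\<^sup>2) powr (real N - 1 / p) / \<phi> (cmod w)) *
     (of_real \<alpha> / (1 - cnj w * z) ^ N + of_real (\<beta> * (1 - (cmod w)\<^sup>2)) / (1 - cnj w * z) ^ (N + 1)))"

lemma test_function_eq:
  "z \<in> disk \<Longrightarrow> test_function p \<phi> N \<alpha> \<beta> w z =
     of_real ((1 - (cmod w)\<^sup>2) powr (real N - 1 / p) / \<phi> (cmod w)) *
     (of_real \<alpha> / (1 - cnj w * z) ^ N + of_real (\<beta> * (1 - (cmod w)\<^sup>2)) / (1 - cnj w * z) ^ (N + 1))"
  by (simp add: test_function_def)

lemma kernel_lower_bound:
  assumes "w \<in> disk" "z \<in> disk"
  shows "1 - cmod z \<le> cmod (1 - cnj w * z)" "1 - cmod w \<le> cmod (1 - cnj w * z)" "1 - cnj w * z \<noteq> 0"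
proof -
  have 1: "1 - cmod w * cmod z \<le> cmod (1 - cnj w * z)"
    using norm_triangle_ineq2[of 1 "cnj w * z"] by (simp add: norm_mult)
  have 2: "cmod w * cmod z \<le> cmod z" "cmod w * cmod z \<le> cmod w"
    using assms by (auto simp: mult_left_le mult_left_le_one_le)
  show 3: "1 - cmod z \<le> cmod (1 - cnj w * z)" "1 - cmod w \<le> cmod (1 - cnj w * z)"
    using 1 2 by linarith+
  show "1 - cnj w * z \<noteq> 0"
    using 3(1) assms(2) by force
qed

lemma has_field_derivative_test_function:
  assumes w: "w \<in> disk" and z: "z \<in> disk"
  shows "(test_function p \<phi> N \<alpha> \<beta> w has_field_derivative
    of_real ((1 - (cmod w)\<^sup>2) powr (real N - 1 / p) / \<phi> (cmod w)) * cnj w *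
     (of_real (\<alpha> * real N) / (1 - cnj w * z) ^ (N + 1)
       + of_real (\<beta> * (1 - (cmod w)\<^sup>2) * real (N + 1)) / (1 - cnj w * z) ^ (N + 2))) (at z)"
proof -
  note nz = kernel_lower_bound(3)[OF w z]
  let ?\<kappa> = "complex_of_real ((1 - (cmod w)\<^sup>2) powr (real N - 1 / p) / \<phi> (cmod w))"
  have "((\<lambda>z. ?\<kappa> * (of_real \<alpha> / (1 - cnj w * z) ^ N + of_real (\<beta> * (1 - (cmod w)\<^sup>2)) / (1 - cnj w * z) ^ (N + 1)))
      has_field_derivative ?\<kappa> * (of_real \<alpha> * of_nat N * cnj w / (1 - cnj w * z) ^ (N + 1)
       + of_real (\<beta> * (1 - (cmod w)\<^sup>2)) * of_nat (N + 1) * cnj w / (1 - cnj w * z) ^ (N + 1 + 1))) (at z)"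
    by (intro DERIV_cmult DERIV_add has_field_derivative_inverse_power_affine nz)
  also have "?\<kappa> * (of_real \<alpha> * of_nat N * cnj w / (1 - cnj w * z) ^ (N + 1)
       + of_real (\<beta> * (1 - (cmod w)\<^sup>2)) * of_nat (N + 1) * cnj w / (1 - cnj w * z) ^ (N + 1 + 1))
     = ?\<kappa> * cnj w * (of_real (\<alpha> * real N) / (1 - cnj w * z) ^ (N + 1)
       + of_real (\<beta> * (1 - (cmod w)\<^sup>2) * real (N + 1)) / (1 - cnj w * z) ^ (N + 2))"
    by (simp add: distrib_left mult_ac)
  finally show ?thesis
    by (rule has_field_derivative_transform_within_open[OF _ open_ball z]) (simp add: test_function_def)
qed

lemmas deriv_test_function = DERIV_imp_deriv[OF has_field_derivative_test_function]

lemma test_function_hol_disk: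
  assumes "w \<in> disk"
  shows "test_function p \<phi> N \<alpha> \<beta> w \<in> hol_disk"
proof -
  have "test_function p \<phi> N \<alpha> \<beta> w holomorphic_on disk"
    unfolding holomorphic_on_open[OF open_ball] using has_field_derivative_test_function[OF assms] by blast
  then show ?thesis by (simp add: hol_disk_def test_function_def)
qed

lemma test_function_at_centre:
  assumes w: "w \<in> disk" and \<phi>: "0 < \<phi> (cmod w)"
  shows "test_function p \<phi> N \<alpha> \<beta> w w = of_real ((\<alpha> + \<beta>) / (\<phi> (cmod w) * (1 - (cmod w)\<^sup>2) powr (1 / p)))"
    and "deriv (test_function p \<phi> N \<alpha> \<beta> w) w
      = of_real ((\<alpha> * real N + \<beta> * real (N + 1)) / (\<phi> (cmod w) * (1 - (cmod w)\<^sup>2) powr (1 + 1 / p))) * cnj w"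
proof -
  define q where "q = 1 - (cmod w)\<^sup>2"
  have q: "0 < q" using w by (simp add: q_def power_less_one_iff abs_square_less_1)
  have e: "1 - cnj w * w = of_real q"
    using complex_norm_square[of w] by (simp add: q_def mult.commute)
  have 1: "q powr (real N - 1 / p) / q ^ N = 1 / q powr (1 / p)"
    using q by (simp add: powr_diff powr_realpow)
  have "test_function p \<phi> N \<alpha> \<beta> w w
      = of_real (q powr (real N - 1 / p) / \<phi> (cmod w) * (\<alpha> / q ^ N + \<beta> * q / q ^ (N + 1)))"
    unfolding test_function_eq[OF w] e q_def[symmetric] by simp
  also have "q powr (real N - 1 / p) / \<phi> (cmod w) * (\<alpha> / q ^ N + \<beta> * q / q ^ (N + 1))
      = (\<alpha> + \<beta>) / \<phi> (cmod w) * (q powr (real N - 1 / p) / q ^ N)"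
    using q by (simp add: field_simps)
  finally show "test_function p \<phi> N \<alpha> \<beta> w w = of_real ((\<alpha> + \<beta>) / (\<phi> (cmod w) * (1 - (cmod w)\<^sup>2) powr (1 / p)))"
    unfolding 1 by (simp add: q_def)
  have 2: "\<alpha> * real N / q ^ (N + 1) + \<beta> * q * real (N + 1) / q ^ (N + 2)
      = (\<alpha> * real N + \<beta> * real (N + 1)) / (q ^ N * q)"
    using q by (simp add: field_simps)
  have "deriv (test_function p \<phi> N \<alpha> \<beta> w) w
      = of_real (q powr (real N - 1 / p) / \<phi> (cmod w) * (\<alpha> * real N / q ^ (N + 1) + \<beta> * q * real (N + 1) / q ^ (N + 2))) * cnj w"
    unfolding deriv_test_function[OF w w] e q_def[symmetric] by simp
  also have "q powr (real N - 1 / p) / \<phi> (cmod w) * (\<alpha> * real N / q ^ (N + 1) + \<beta> * q * real (N + 1) / q ^ (N + 2))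
      = (\<alpha> * real N + \<beta> * real (N + 1)) / \<phi> (cmod w) * (q powr (real N - 1 / p) / q ^ N / q)"
    unfolding 2 by simp
  finally show "deriv (test_function p \<phi> N \<alpha> \<beta> w) w
      = of_real ((\<alpha> * real N + \<beta> * real (N + 1)) / (\<phi> (cmod w) * (1 - (cmod w)\<^sup>2) powr (1 + 1 / p))) * cnj w"
    unfolding 1 using q by (simp add: q_def powr_add mult_ac)
qed

text \<open>
  Since \<open>1 - |w|\<^sup>2 \<le> 2 |1 - cnj w z|\<close>, the term with the higher power of the kernel is controlled by the other one.
\<close>

lemma test_function_bounds:
  fixes \<phi> :: "real \<Rightarrow> real" and p :: real and N :: nat
  assumes w: "w \<in> disk" and z: "z \<in> disk" and \<phi>: "0 < \<phi> (cmod w)"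
  defines "\<kappa> \<equiv> (1 - (cmod w)\<^sup>2) powr (real N - 1 / p) / \<phi> (cmod w)"
  shows "cmod (test_function p \<phi> N \<alpha> \<beta> w z) \<le> (\<bar>\<alpha>\<bar> + 2 * \<bar>\<beta>\<bar>) * \<kappa> / cmod (1 - cnj w * z) ^ N"
    and "cmod (deriv (test_function p \<phi> N \<alpha> \<beta> w) z)
      \<le> (\<bar>\<alpha>\<bar> * real N + 2 * \<bar>\<beta>\<bar> * real (N + 1)) * \<kappa> / cmod (1 - cnj w * z) ^ (N + 1)"
proof -
  define q where "q = 1 - (cmod w)\<^sup>2"
  define k where "k = 1 - cnj w * z"
  have q0: "0 \<le> q" unfolding q_def by (rule disk_weight_nonneg[OF w])
  have k0: "0 < cmod k" using kernel_lower_bound(3)[OF w z] by (simp add: k_def)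
  have "q = (1 + cmod w) * (1 - cmod w)" by (simp add: q_def power2_eq_square algebra_simps)
  also have "\<dots> \<le> 2 * (1 - cmod w)" using w by (intro mult_right_mono) auto
  also have "\<dots> \<le> 2 * cmod k" using kernel_lower_bound(2)[OF w z] by (simp add: k_def)
  finally have q: "q / cmod k \<le> 2" using k0 by (simp add: divide_le_eq)
  have \<kappa>: "0 \<le> \<kappa>" using \<phi> by (simp add: \<kappa>_def)
  have gen: "cmod (of_real a / k ^ n + of_real (b * q) / k ^ (n + 1)) \<le> (\<bar>a\<bar> + 2 * \<bar>b\<bar>) / cmod k ^ n" for a b n
  proof -
    have "cmod (of_real a / k ^ n + of_real (b * q) / k ^ (n + 1)) \<le> \<bar>a\<bar> / cmod k ^ n + \<bar>b\<bar> * q / cmod k ^ (n + 1)"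
      using norm_triangle_ineq[of "of_real a / k ^ n" "of_real (b * q) / k ^ (n + 1)"] q0
      by (simp add: norm_divide norm_mult norm_power)
    also have "\<dots> = (\<bar>a\<bar> + \<bar>b\<bar> * (q / cmod k)) / cmod k ^ n"
      using k0 by (simp add: field_simps)
    also have "\<dots> \<le> (\<bar>a\<bar> + \<bar>b\<bar> * 2) / cmod k ^ n"
      using q by (intro divide_right_mono add_left_mono mult_left_mono) auto
    finally show ?thesis by (simp add: mult.commute)
  qed
  have "cmod (test_function p \<phi> N \<alpha> \<beta> w z) = \<kappa> * cmod (of_real \<alpha> / k ^ N + of_real (\<beta> * q) / k ^ (N + 1))"
    unfolding test_function_eq[OF z] \<kappa>_def[symmetric]
    unfolding q_def[symmetric] k_def[symmetric]
    using \<kappa> by (simp add: norm_mult)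
  also have "\<dots> \<le> \<kappa> * ((\<bar>\<alpha>\<bar> + 2 * \<bar>\<beta>\<bar>) / cmod k ^ N)"
    using \<kappa> by (intro mult_left_mono gen)
  finally show "cmod (test_function p \<phi> N \<alpha> \<beta> w z) \<le> (\<bar>\<alpha>\<bar> + 2 * \<bar>\<beta>\<bar>) * \<kappa> / cmod (1 - cnj w * z) ^ N"
    by (simp add: k_def mult.commute)
  have "cmod (deriv (test_function p \<phi> N \<alpha> \<beta> w) z)
      = \<kappa> * cmod w * cmod (of_real (\<alpha> * real N) / k ^ (N + 1) + of_real (\<beta> * real (N + 1) * q) / k ^ (N + 1 + 1))"
    unfolding deriv_test_function[OF w z] \<kappa>_def[symmetric]
    unfolding q_def[symmetric] k_def[symmetric]
    using \<kappa> by (simp add: norm_mult mult_ac)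
  also have "\<dots> \<le> \<kappa> * 1 * ((\<bar>\<alpha> * real N\<bar> + 2 * \<bar>\<beta> * real (N + 1)\<bar>) / cmod k ^ (N + 1))"
    using \<kappa> w by (intro mult_mono gen) auto
  finally show "cmod (deriv (test_function p \<phi> N \<alpha> \<beta> w) z)
      \<le> (\<bar>\<alpha>\<bar> * real N + 2 * \<bar>\<beta>\<bar> * real (N + 1)) * \<kappa> / cmod (1 - cnj w * z) ^ (N + 1)"
    by (simp add: k_def abs_mult mult_ac)
qed

lemma Hpp_integral_bound_imp:
  assumes p: "0 < p" and f: "f \<in> hol_disk" and M: "0 \<le> M" "Hpp_integral p \<phi> f \<le> ennreal M"
  shows "f \<in> Hpp p \<phi>" and "Hpp_norm p \<phi> f \<le> M powr (1 / p)"
proof -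
  have "Hpp_integral p \<phi> f < \<infinity>" using M(2) by (rule le_less_trans) simp
  then show "f \<in> Hpp p \<phi>" using f by (simp add: Hpp_def)
  have "enn2real (Hpp_integral p \<phi> f) \<le> M"
    using enn2real_mono[OF M(2)] M(1) by simp
  then show "Hpp_norm p \<phi> f \<le> M powr (1 / p)"
    unfolding Hpp_norm_def using p by (intro powr_mono2) auto
qed

lemma exists_test_exponent:
  fixes p x :: real
  assumes "0 < p"
  obtains N :: nat where "2 \<le> real N * p" "1 + x * p < real N * p"
proof -
  obtain N :: nat where "max 2 (2 + x * p) / p < real N"
    using reals_Archimedean2 by blast
  then have "max 2 (2 + x * p) < real N * p" using assms by (simp add: divide_less_eq)
  then have "2 \<le> real N * p" "1 + x * p < real N * p" by auto
  then show thesis by (rule that)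
qed

context growth_weight
begin

lemma test_function_Hpp_norm_bound:
  assumes p: "0 < p" and N: "2 \<le> real N * p" "1 + t * p < real N * p"
  obtains M where "\<And>w. w \<in> disk \<Longrightarrow> test_function p \<phi> N \<alpha> \<beta> w \<in> Hpp p \<phi>"
    "\<And>w. w \<in> disk \<Longrightarrow> Hpp_norm p \<phi> (test_function p \<phi> N \<alpha> \<beta> w) \<le> M"
proof -
  define K where "K = \<bar>\<alpha>\<bar> + 2 * \<bar>\<beta>\<bar>"
  have K: "0 \<le> K" by (simp add: K_def)
  obtain M where M: "0 \<le> M"
    "\<And>w g. w \<in> disk \<Longrightarrow> g holomorphic_on disk \<Longrightarrow>
       (\<And>z. z \<in> disk \<Longrightarrow> cmod (g z) \<le> K * (1 - (cmod w)\<^sup>2) powr (real N - 1 / p) / \<phi> (cmod w) / cmod (1 - cnj w * z) ^ N) \<Longrightarrow>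
       Hpp_integral p \<phi> g \<le> ennreal M"
    by (rule test_function_Hpp_bound[OF p N K]) blast
  have "Hpp_integral p \<phi> (test_function p \<phi> N \<alpha> \<beta> w) \<le> ennreal M" if w: "w \<in> disk" for w
  proof (rule M(2)[OF w])
    show "test_function p \<phi> N \<alpha> \<beta> w holomorphic_on disk"
      using test_function_hol_disk[OF w] by (simp add: hol_disk_def)
    fix z :: complex assume z: "z \<in> disk"
    have "0 < \<phi> (cmod w)" using w by (intro pos) auto
    from test_function_bounds(1)[where \<phi> = \<phi> and \<alpha> = \<alpha> and \<beta> = \<beta> and p = p and N = N, OF w z this]
    show "cmod (test_function p \<phi> N \<alpha> \<beta> w z) \<le> K * (1 - (cmod w)\<^sup>2) powr (real N - 1 / p) / \<phi> (cmod w) / cmod (1 - cnj w * z) ^ N"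
      by (simp add: K_def)
  qed
  note Hpp_integral_bound_imp[OF p test_function_hol_disk M(1) this]
  then show thesis using that by blast
qed

text \<open>
  By the lower bound of the weight \<open>\<phi>(b)\<close> is at least a multiple of \<open>(1 - b) powr t\<close>, and the power
  in the numerator has the larger exponent \<open>N - 1/p\<close>.
\<close>

lemma test_factor_tendsto_0:
  assumes p: "0 < p" and N: "1 + t * p < real N * p"
    and w: "range w \<subseteq> disk" "(\<lambda>n::nat. cmod (w n)) \<longlonglongrightarrow> 1"
  shows "(\<lambda>n. (1 - (cmod (w n))\<^sup>2) powr (real N - 1 / p) / \<phi> (cmod (w n))) \<longlonglongrightarrow> 0"
proof -
  define m where "m = real N - 1 / p"
  have m: "t < m" using p N by (simp add: m_def field_simps)
  define L where "L = 2 powr m * C / \<phi> 0"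
  have \<phi>0: "0 < \<phi> 0" by (intro pos) auto
  have bound: "(1 - b\<^sup>2) powr m / \<phi> b \<le> L * (1 - b) powr (m - t)" if b: "0 \<le> b" "b < 1" for b
  proof -
    have \<phi>b: "0 < \<phi> b" using b by (rule pos)
    have "1 - b\<^sup>2 = (1 + b) * (1 - b)" by (simp add: power2_eq_square algebra_simps)
    also have "\<dots> \<le> 2 * (1 - b)" using b by (intro mult_right_mono) auto
    finally have "(1 - b\<^sup>2) powr m \<le> (2 * (1 - b)) powr m"
      using b m t_pos by (intro powr_mono2) (auto simp: power_le_one)
    also have "\<dots> = 2 powr m * (1 - b) powr m" by (rule powr_mult)
    finally have 1: "(1 - b\<^sup>2) powr m \<le> 2 powr m * (1 - b) powr m" .
    have "\<phi> 0 \<le> C * \<phi> b * ((1 - 0) / (1 - b)) powr t" using b by (intro lower) auto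
    then have 2: "\<phi> 0 * (1 - b) powr t \<le> C * \<phi> b" using b by (simp add: powr_divide field_simps)
    have "(1 - b\<^sup>2) powr m / \<phi> b \<le> (2 powr m * (1 - b) powr m) / (\<phi> 0 * (1 - b) powr t / C)"
      using 1 2 \<phi>0 \<phi>b C_ge_1 b by (intro frac_le) (auto simp: divide_le_eq mult.commute)
    also have "\<dots> = L * (1 - b) powr (m - t)"
      by (simp add: L_def powr_diff)
    finally show ?thesis .
  qed
  have "(\<lambda>n. 1 - cmod (w n)) \<longlonglongrightarrow> 1 - 1" by (intro tendsto_intros w)
  then have "(\<lambda>n. (1 - cmod (w n)) powr (m - t)) \<longlonglongrightarrow> 0"
    using m w(1) tendsto_zero_powrI[of "\<lambda>n. 1 - cmod (w n)" sequentially "\<lambda>_. m - t" "m - t"]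
    by (force intro!: always_eventually less_imp_le)
  from tendsto_mult_left[OF this, of L]
  have lim: "(\<lambda>n. L * (1 - cmod (w n)) powr (m - t)) \<longlonglongrightarrow> 0" by simp
  have "w n \<in> disk" for n using w(1) by blast
  then have dw: "cmod (w n) < 1" for n by simp
  show ?thesis
    unfolding m_def[symmetric]
    by (rule tendsto_sandwich[OF _ _ tendsto_const lim])
      (use bound dw pos in \<open>auto intro!: always_eventually divide_nonneg_pos\<close>)
qed

lemma test_function_tendsto_0:
  assumes p: "0 < p" and N: "1 + t * p < real N * p"
    and w: "range w \<subseteq> disk" "(\<lambda>n::nat. cmod (w n)) \<longlonglongrightarrow> 1" and z: "z \<in> disk"
  shows "(\<lambda>n. test_function p \<phi> N \<alpha> \<beta> (w n) z) \<longlonglongrightarrow> 0"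
    and "(\<lambda>n. deriv (test_function p \<phi> N \<alpha> \<beta> (w n)) z) \<longlonglongrightarrow> 0"
proof -
  define \<kappa> where "\<kappa> = (\<lambda>n. (1 - (cmod (w n))\<^sup>2) powr (real N - 1 / p) / \<phi> (cmod (w n)))"
  have \<kappa>_eq: "(1 - (cmod (w n))\<^sup>2) powr (real N - 1 / p) / \<phi> (cmod (w n)) = \<kappa> n" for n
    by (simp add: \<kappa>_def)
  have \<kappa>: "\<kappa> \<longlonglongrightarrow> 0" unfolding \<kappa>_def by (rule test_factor_tendsto_0[OF p N w])
  have wd: "w n \<in> disk" for n using w(1) by blast
  have ph: "0 < \<phi> (cmod (w n))" for n using wd[of n] by (intro pos) auto
  have \<kappa>0: "0 \<le> \<kappa> n" for n using ph[of n] by (simp add: \<kappa>_def)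
  have z1: "0 < 1 - cmod z" using z by simp
  have lim: "(\<lambda>n. A * \<kappa> n / (1 - cmod z) ^ k) \<longlonglongrightarrow> 0" for A k
    using tendsto_divide[OF tendsto_mult_left[OF \<kappa>, of A] tendsto_const[of "(1 - cmod z) ^ k"]] z1 by simp
  have le: "A * \<kappa> n / cmod (1 - cnj (w n) * z) ^ k \<le> A * \<kappa> n / (1 - cmod z) ^ k" if "0 \<le> A" for A n k
    using that \<kappa>0[of n] z1 kernel_lower_bound[OF wd z, of n]
    by (intro divide_left_mono power_mono mult_pos_pos zero_less_power mult_nonneg_nonneg) auto
  have "cmod (test_function p \<phi> N \<alpha> \<beta> (w n) z) \<le> (\<bar>\<alpha>\<bar> + 2 * \<bar>\<beta>\<bar>) * \<kappa> n / (1 - cmod z) ^ N" for n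
    using test_function_bounds(1)[where \<phi> = \<phi> and \<alpha> = \<alpha> and \<beta> = \<beta> and p = p and N = N, OF wd z ph, of n] unfolding \<kappa>_eq
    by (rule order_trans[OF _ le]) auto
  then show "(\<lambda>n. test_function p \<phi> N \<alpha> \<beta> (w n) z) \<longlonglongrightarrow> 0"
    by (intro Lim_null_comparison[OF _ lim] always_eventually allI)
  have "cmod (deriv (test_function p \<phi> N \<alpha> \<beta> (w n)) z)
      \<le> (\<bar>\<alpha>\<bar> * real N + 2 * \<bar>\<beta>\<bar> * real (N + 1)) * \<kappa> n / (1 - cmod z) ^ (N + 1)" for n
    using test_function_bounds(2)[where \<phi> = \<phi> and \<alpha> = \<alpha> and \<beta> = \<beta> and p = p and N = N, OF wd z ph, of n] unfolding \<kappa>_eq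
    by (rule order_trans[OF _ le]) auto
  then show "(\<lambda>n. deriv (test_function p \<phi> N \<alpha> \<beta> (w n)) z) \<longlonglongrightarrow> 0"
    by (intro Lim_null_comparison[OF _ lim] always_eventually allI)
qed

end

section \<open>The Bloch space\<close>

lemma bloch_seminorm_le:
  assumes "\<And>z. z \<in> disk \<Longrightarrow> (1 - (cmod z)\<^sup>2) * cmod (deriv h z) \<le> e"
  shows "bloch_seminorm h \<le> ennreal e"
  unfolding bloch_seminorm_def using assms by (intro SUP_least ennreal_leI)

lemma deriv_le_bloch_seminorm:
  assumes "bloch_seminorm h < \<infinity>" "z \<in> disk"
  shows "(1 - (cmod z)\<^sup>2) * cmod (deriv h z) \<le> enn2real (bloch_seminorm h)"
proof -
  have "ennreal ((1 - (cmod z)\<^sup>2) * cmod (deriv h z)) \<le> bloch_seminorm h"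
    unfolding bloch_seminorm_def using assms(2) by (rule SUP_upper)
  then have "enn2real (ennreal ((1 - (cmod z)\<^sup>2) * cmod (deriv h z))) \<le> enn2real (bloch_seminorm h)"
    using assms(1) by (intro enn2real_mono) auto
  then show ?thesis using disk_weight_nonneg[OF assms(2)] by simp
qed

lemma deriv_diff_disk:
  assumes "f holomorphic_on disk" "g holomorphic_on disk" "z \<in> disk"
  shows "deriv (\<lambda>z. f z - g z) z = deriv f z - deriv g z"
  using assms by (intro deriv_diff holomorphic_on_imp_differentiable_at[OF _ open_ball]) auto

lemma bloch_dist_le:
  assumes "f holomorphic_on disk" "g holomorphic_on disk" "0 \<le> e"
    and "\<And>z. z \<in> disk \<Longrightarrow> (1 - (cmod z)\<^sup>2) * cmod (deriv f z - deriv g z) \<le> e"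
  shows "bloch_dist f g \<le> cmod (f 0 - g 0) + e"
proof -
  have "bloch_seminorm (\<lambda>z. f z - g z) \<le> ennreal e"
    using assms by (intro bloch_seminorm_le) (simp add: deriv_diff_disk)
  then have "enn2real (bloch_seminorm (\<lambda>z. f z - g z)) \<le> e"
    using assms(3) enn2real_mono[of _ "ennreal e"] by fastforce
  then show ?thesis by (simp add: bloch_dist_def bloch_norm_def)
qed

lemma deriv_diff_le_bloch_dist:
  assumes "f \<in> bloch" "g \<in> bloch" "z \<in> disk"
  shows "(1 - (cmod z)\<^sup>2) * cmod (deriv f z - deriv g z) \<le> bloch_dist f g"
proof -
  have "(1 - (cmod z)\<^sup>2) * cmod (deriv (\<lambda>z. f z - g z) z) \<le> enn2real (bloch_seminorm (\<lambda>z. f z - g z))"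
    using assms by (intro deriv_le_bloch_seminorm bloch_diff_finite)
  also have "\<dots> \<le> bloch_dist f g" by (simp add: bloch_dist_def bloch_norm_def)
  finally show ?thesis using assms by (simp add: deriv_diff_disk bloch_def hol_disk_def)
qed

lemma in_bloch_of_deriv_close:
  assumes f: "f \<in> bloch" and g: "g \<in> hol_disk"
    and le: "\<And>z. z \<in> disk \<Longrightarrow> (1 - (cmod z)\<^sup>2) * cmod (deriv f z - deriv g z) \<le> e"
  shows "g \<in> bloch"
proof -
  have "bloch_seminorm g \<le> ennreal (enn2real (bloch_seminorm f) + e)"
  proof (rule bloch_seminorm_le)
    fix z :: complex assume z: "z \<in> disk"
    have "cmod (deriv g z) \<le> cmod (deriv f z) + cmod (deriv f z - deriv g z)"
      using norm_triangle_ineq4[of "deriv f z" "deriv f z - deriv g z"] by simp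
    then have "(1 - (cmod z)\<^sup>2) * cmod (deriv g z)
        \<le> (1 - (cmod z)\<^sup>2) * (cmod (deriv f z) + cmod (deriv f z - deriv g z))"
      using disk_weight_nonneg[OF z] by (intro mult_left_mono)
    also have "\<dots> \<le> enn2real (bloch_seminorm f) + e"
      using le[OF z] deriv_le_bloch_seminorm[OF _ z, of f] f by (simp add: bloch_def distrib_left)
    finally show "(1 - (cmod z)\<^sup>2) * cmod (deriv g z) \<le> enn2real (bloch_seminorm f) + e" .
  qed
  also have "\<dots> < \<infinity>" by simp
  finally show ?thesis using g by (simp add: bloch_def)
qed

text \<open>
  For relative compactness in a metric space it suffices to extract convergent subsequences from
  sequences in the set itself instead of its closure.
\<close>

lemma compactin_bloch_closure_of:
  assumes "S \<subseteq> bloch"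
    and "\<And>\<sigma>. range \<sigma> \<subseteq> S \<Longrightarrow>
      \<exists>l\<in>bloch. \<exists>r. strict_mono (r :: nat \<Rightarrow> nat) \<and> (\<lambda>n. bloch_dist (\<sigma> (r n)) l) \<longlonglongrightarrow> 0"
  shows "compactin bloch_topology (bloch_topology closure_of S)"
proof -
  interpret Metric_space bloch bloch_dist by (rule Metric_space_bloch)
  have "\<exists>l r. l \<in> bloch \<and> strict_mono r \<and> limitin mtopology (\<sigma> \<circ> r) l sequentially"
    if \<sigma>: "range \<sigma> \<subseteq> S" for \<sigma> :: "nat \<Rightarrow> complex \<Rightarrow> complex"
  proof -
    obtain l r where lr: "l \<in> bloch" "strict_mono (r :: nat \<Rightarrow> nat)" "(\<lambda>n. bloch_dist (\<sigma> (r n)) l) \<longlonglongrightarrow> 0"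
      using assms(2)[OF \<sigma>] by blast
    moreover have "\<sigma> n \<in> bloch" for n using \<sigma> assms(1) by auto
    ultimately show ?thesis by (auto simp: limitin_metric_dist_null o_def)
  qed
  then have "\<forall>T. T \<subseteq> S \<and> infinite T \<longrightarrow> bloch \<inter> mtopology derived_set_of T \<noteq> {}"
    using Bolzano_Weierstrass_property[OF assms(1) assms(1)] by blast
  then show ?thesis
    unfolding bloch_topology_def compact_closure_of_eq_Bolzano_Weierstrass by blast
qed

section \<open>Weighted composition operators\<close>

locale weighted_composition = growth_weight \<phi> s t C for \<phi> s t C +
  fixes p :: real and u varphi :: "complex \<Rightarrow> complex"
  assumes p_pos: "0 < p" and varphi: "varphi holomorphic_on disk" "varphi ` disk \<subseteq> disk"
    and u: "u holomorphic_on disk"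
begin

abbreviation "T \<equiv> weighted_comp u varphi"

lemma varphi_in_disk: "z \<in> disk \<Longrightarrow> varphi z \<in> disk"
  using varphi by blast

lemma has_field_derivative_weighted_comp:
  assumes f: "f holomorphic_on disk" and z: "z \<in> disk"
  shows "(T f has_field_derivative
    deriv u z * f (varphi z) + u z * (deriv f (varphi z) * deriv varphi z)) (at z)"
proof -
  have 1: "(u has_field_derivative deriv u z) (at z)"
    by (rule holomorphic_derivI[OF u open_ball z])
  have 2: "(varphi has_field_derivative deriv varphi z) (at z)"
    by (rule holomorphic_derivI[OF varphi(1) open_ball z])
  have 3: "(f has_field_derivative deriv f (varphi z)) (at (varphi z))"
    by (rule holomorphic_derivI[OF f open_ball varphi_in_disk[OF z]])
  have "((\<lambda>z. u z * f (varphi z)) has_field_derivative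
      deriv u z * f (varphi z) + u z * (deriv f (varphi z) * deriv varphi z)) (at z)"
    using DERIV_mult[OF 1 DERIV_chain2[OF 3 2]] by (simp add: mult_ac add_ac)
  then show ?thesis
    by (rule has_field_derivative_transform_within_open[OF _ open_ball z]) (simp add: weighted_comp_def)
qed

lemmas deriv_weighted_comp = DERIV_imp_deriv[OF has_field_derivative_weighted_comp]

lemma weighted_comp_hol_disk:
  assumes "f holomorphic_on disk"
  shows "T f \<in> hol_disk"
proof -
  have "T f holomorphic_on disk"
    unfolding holomorphic_on_open[OF open_ball] using has_field_derivative_weighted_comp[OF assms] by blast
  then show ?thesis by (simp add: hol_disk_def weighted_comp_def)
qed

end

section \<open>Compactness implies the boundary conditions\<close>

lemma tends_to_zero_at_boundary_mono:
  assumes F: "tends_to_zero_at_boundary varphi F" and c: "c < 1"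
    and le: "\<And>z. z \<in> disk \<Longrightarrow> c < cmod (varphi z) \<Longrightarrow> cmod (varphi z) < 1 \<Longrightarrow> \<bar>G z\<bar> \<le> K * \<bar>F z\<bar>"
    and K: "0 < K"
  shows "tends_to_zero_at_boundary varphi G"
  unfolding tends_to_zero_at_boundary_def
proof (intro allI impI)
  fix \<epsilon> :: real assume "0 < \<epsilon>"
  then have "0 < \<epsilon> / K" using K by simp
  then obtain \<delta> where \<delta>: "\<delta> \<in> {0<..<1}"
    "\<And>z. z \<in> disk \<Longrightarrow> \<delta> < cmod (varphi z) \<Longrightarrow> cmod (varphi z) < 1 \<Longrightarrow> \<bar>F z\<bar> < \<epsilon> / K"
    using F unfolding tends_to_zero_at_boundary_def by blast
  show "\<exists>\<delta>\<in>{0<..<1}. \<forall>z\<in>disk. \<delta> < cmod (varphi z) \<and> cmod (varphi z) < 1 \<longrightarrow> \<bar>G z\<bar> < \<epsilon>"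
  proof (intro bexI ballI impI)
    show "max \<delta> c \<in> {0<..<1}" using \<delta>(1) c by auto
    fix z assume z: "z \<in> disk" "max \<delta> c < cmod (varphi z) \<and> cmod (varphi z) < 1"
    then have "K * \<bar>F z\<bar> < \<epsilon>" using \<delta>(2)[of z] K by (simp add: less_divide_eq mult.commute)
    moreover have "\<bar>G z\<bar> \<le> K * \<bar>F z\<bar>" using z by (intro le) auto
    ultimately show "\<bar>G z\<bar> < \<epsilon>" by linarith
  qed
qed

context weighted_composition
begin

text \<open>
  Otherwise some sequence \<open>\<zeta>\<close> with \<open>|varphi (\<zeta> n)|\<close> tending to 1 keeps the expression above some \<open>\<epsilon> > 0\<close>.
  A subsequence of the images of \<open>F (varphi (\<zeta> n))\<close> converges in the Bloch space to some \<open>l\<close>, and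
  \<open>l\<close> has derivative 0 because the derivatives of the images tend to 0 pointwise. So the Bloch seminorms of the
  images along the subsequence tend to 0, although evaluation at \<open>\<zeta> n\<close> shows that they are at least \<open>\<epsilon>\<close>.
\<close>

lemma compact_imp_tends_to_zero:
  fixes F :: "complex \<Rightarrow> complex \<Rightarrow> complex"
  assumes cpt: "compact_operator (Hpp p \<phi>) (Hpp_norm p \<phi>) bloch_topology T"
    and F: "\<And>w. w \<in> disk \<Longrightarrow> F w \<in> Hpp p \<phi>" and M: "\<And>w. w \<in> disk \<Longrightarrow> Hpp_norm p \<phi> (F w) \<le> M"
    and lim: "\<And>w z. range w \<subseteq> disk \<Longrightarrow> (\<lambda>n::nat. cmod (w n)) \<longlonglongrightarrow> 1 \<Longrightarrow> z \<in> disk \<Longrightarrow>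
      (\<lambda>n. F (w n) z) \<longlonglongrightarrow> 0"
    and lim': "\<And>w z. range w \<subseteq> disk \<Longrightarrow> (\<lambda>n::nat. cmod (w n)) \<longlonglongrightarrow> 1 \<Longrightarrow> z \<in> disk \<Longrightarrow>
      (\<lambda>n. deriv (F (w n)) z) \<longlonglongrightarrow> 0"
  shows "tends_to_zero_at_boundary varphi (\<lambda>z. (1 - (cmod z)\<^sup>2) * cmod (deriv (T (F (varphi z))) z))"
proof (rule ccontr)
  interpret B: Metric_space bloch bloch_dist by (rule Metric_space_bloch)
  assume "\<not> ?thesis"
  then obtain \<epsilon> where \<epsilon>: "0 < \<epsilon>" and ex0: "\<forall>\<delta>\<in>{0<..<1}.
      \<exists>z\<in>disk. \<delta> < cmod (varphi z) \<and> \<not> \<bar>(1 - (cmod z)\<^sup>2) * cmod (deriv (T (F (varphi z))) z)\<bar> < \<epsilon>"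
    unfolding tends_to_zero_at_boundary_def by blast
  have ex: "\<exists>z\<in>disk. \<delta> < cmod (varphi z) \<and> \<epsilon> \<le> \<bar>(1 - (cmod z)\<^sup>2) * cmod (deriv (T (F (varphi z))) z)\<bar>"
    if "0 < \<delta>" "\<delta> < 1" for \<delta>
    using ex0 that unfolding not_less by simp
  have "\<exists>z\<in>disk. 1 - 1 / real (n + 2) < cmod (varphi z) \<and>
      \<epsilon> \<le> \<bar>(1 - (cmod z)\<^sup>2) * cmod (deriv (T (F (varphi z))) z)\<bar>" for n :: nat
    by (rule ex) auto
  then obtain \<zeta> where \<zeta>: "\<And>n. \<zeta> n \<in> disk" "\<And>n::nat. 1 - 1 / real (n + 2) < cmod (varphi (\<zeta> n))"
      "\<And>n. \<epsilon> \<le> \<bar>(1 - (cmod (\<zeta> n))\<^sup>2) * cmod (deriv (T (F (varphi (\<zeta> n)))) (\<zeta> n))\<bar>"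
    by metis
  define w where "w = (\<lambda>n. varphi (\<zeta> n))"
  have w: "w n \<in> disk" for n unfolding w_def by (intro varphi_in_disk \<zeta>)
  have hol: "F (w n) holomorphic_on disk" for n
    using F[OF w] by (simp add: Hpp_def hol_disk_def)
  have w_lim: "(\<lambda>n. cmod (w n)) \<longlonglongrightarrow> 1"
  proof (rule tendsto_sandwich)
    show "\<forall>\<^sub>F n in sequentially. 1 - 1 / real (n + 2) \<le> cmod (w n)"
      using \<zeta>(2) by (intro always_eventually allI less_imp_le) (simp add: w_def)
    show "\<forall>\<^sub>F n in sequentially. cmod (w n) \<le> 1"
      using w by (intro always_eventually allI less_imp_le) simp
    have "(\<lambda>n. 1 / real (n + 2)) \<longlonglongrightarrow> 0"
      using LIMSEQ_ignore_initial_segment[OF lim_1_over_n, of 2] by simp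
    from tendsto_diff[OF tendsto_const this, of 1]
    show "(\<lambda>n. 1 - 1 / real (n + 2)) \<longlonglongrightarrow> 1" by simp
  qed simp
  define S where "S = range (\<lambda>n. F (w n))"
  have S: "S \<subseteq> Hpp p \<phi>" "norm_bounded (Hpp_norm p \<phi>) S"
    using F[OF w] M[OF w] by (auto simp: S_def norm_bounded_def)
  have maps: "T \<in> Hpp p \<phi> \<rightarrow> bloch"
    using cpt by (simp add: compact_operator_def topspace_bloch_topology)
  have TS: "T ` S \<subseteq> bloch" using maps S by blast
  have "compactin B.mtopology (B.mtopology closure_of (T ` S))"
    using cpt S by (simp add: compact_operator_def bloch_topology_def)
  moreover have "range (\<lambda>n. T (F (w n))) \<subseteq> B.mtopology closure_of (T ` S)"
    using closure_of_subset[of "T ` S" B.mtopology] TS by (auto simp: S_def)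
  ultimately obtain l r where l: "l \<in> B.mtopology closure_of (T ` S)" and r: "strict_mono (r :: nat \<Rightarrow> nat)"
    and "limitin B.mtopology ((\<lambda>n. T (F (w n))) \<circ> r) l sequentially"
    unfolding B.compactin_sequentially by blast
  then have lb: "l \<in> bloch" and d0: "(\<lambda>n. bloch_dist (T (F (w (r n)))) l) \<longlonglongrightarrow> 0"
    by (auto simp: B.limitin_metric_dist_null o_def)
  have Tb: "T (F (w n)) \<in> bloch" for n using maps F[OF w] by blast
  have lim_r: "(\<lambda>n. cmod (w (r n))) \<longlonglongrightarrow> 1"
    using LIMSEQ_subseq_LIMSEQ[OF w_lim r] by (simp add: o_def)
  have ran: "range (\<lambda>n. w (r n)) \<subseteq> disk" using w by auto
  have dl: "deriv l z = 0" if z: "z \<in> disk" for z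
  proof -
    have "(\<lambda>n. deriv u z * F (w (r n)) (varphi z) + u z * (deriv (F (w (r n))) (varphi z) * deriv varphi z))
        \<longlonglongrightarrow> deriv u z * 0 + u z * (0 * deriv varphi z)"
      by (intro tendsto_intros lim[OF ran lim_r] lim'[OF ran lim_r] varphi_in_disk z)
    then have "(\<lambda>n. deriv (T (F (w (r n)))) z) \<longlonglongrightarrow> 0"
      using deriv_weighted_comp[OF hol z] by simp
    from tendsto_mult_left[OF tendsto_norm[OF tendsto_diff[OF this tendsto_const[of "deriv l z"]]], of "1 - (cmod z)\<^sup>2"]
    have "(\<lambda>n. (1 - (cmod z)\<^sup>2) * cmod (deriv (T (F (w (r n)))) z - deriv l z)) \<longlonglongrightarrow> (1 - (cmod z)\<^sup>2) * cmod (deriv l z)"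
      by simp
    then have "(1 - (cmod z)\<^sup>2) * cmod (deriv l z) \<le> 0"
      by (rule LIMSEQ_le[OF _ d0]) (use deriv_diff_le_bloch_dist[OF Tb lb z] in blast)
    moreover have "1 - (cmod z)\<^sup>2 > 0"
      using z by (simp add: power_less_one_iff abs_square_less_1)
    ultimately show ?thesis by (simp add: mult_le_0_iff)
  qed
  have "\<epsilon> \<le> bloch_dist (T (F (w (r n)))) l" for n
  proof -
    have "\<epsilon> \<le> (1 - (cmod (\<zeta> (r n)))\<^sup>2) * cmod (deriv (T (F (w (r n)))) (\<zeta> (r n)))"
      using \<zeta>(3)[of "r n"] disk_weight_nonneg[OF \<zeta>(1)[of "r n"]] by (simp add: w_def)
    also have "\<dots> \<le> bloch_dist (T (F (w (r n)))) l"
      using deriv_diff_le_bloch_dist[OF Tb lb \<zeta>(1), of "r n" "r n"] dl[OF \<zeta>(1)] by simp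
    finally show ?thesis .
  qed
  then have "\<epsilon> \<le> 0" by (intro LIMSEQ_le_const[OF d0]) auto
  with \<epsilon> show False by simp
qed

text \<open>
  The coefficients \<open>(N + 1, - N)\<close> make the derivative of the test function at \<open>w = varphi z\<close> vanish and
  isolate \<open>u'\<close>; the coefficients \<open>(- 1, 1)\<close> make its value vanish and isolate \<open>u varphi'\<close>.
\<close>

lemma compact_imp_boundary_conditions:
  assumes cpt: "compact_operator (Hpp p \<phi>) (Hpp_norm p \<phi>) bloch_topology T"
  shows "tends_to_zero_at_boundary varphi
      (\<lambda>z. (1 - (cmod z)\<^sup>2) * cmod (deriv u z) /
            (\<phi> (cmod (varphi z)) * (1 - (cmod (varphi z))\<^sup>2) powr (1 / p)))" (is ?i)
    and "tends_to_zero_at_boundary varphi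
      (\<lambda>z. (1 - (cmod z)\<^sup>2) * cmod (u z * deriv varphi z) /
            (\<phi> (cmod (varphi z)) * (1 - (cmod (varphi z))\<^sup>2) powr (1 + 1 / p)))" (is ?ii)
proof -
  obtain N where N: "2 \<le> real N * p" "1 + t * p < real N * p"
    by (rule exists_test_exponent[OF p_pos])
  have main: "tends_to_zero_at_boundary varphi
      (\<lambda>z. (1 - (cmod z)\<^sup>2) * cmod (deriv (T (test_function p \<phi> N \<alpha> \<beta> (varphi z))) z))" for \<alpha> \<beta>
  proof -
    obtain M where M: "\<And>w. w \<in> disk \<Longrightarrow> test_function p \<phi> N \<alpha> \<beta> w \<in> Hpp p \<phi>"
      "\<And>w. w \<in> disk \<Longrightarrow> Hpp_norm p \<phi> (test_function p \<phi> N \<alpha> \<beta> w) \<le> M"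
      by (rule test_function_Hpp_norm_bound[OF p_pos N, of \<alpha> \<beta>]) blast
    show ?thesis
      by (rule compact_imp_tends_to_zero[OF cpt M test_function_tendsto_0[OF p_pos N(2)]])
  qed
  have val: "deriv (T (test_function p \<phi> N \<alpha> \<beta> (varphi z))) z =
      deriv u z * of_real ((\<alpha> + \<beta>) / (\<phi> (cmod (varphi z)) * (1 - (cmod (varphi z))\<^sup>2) powr (1 / p))) +
      u z * (of_real ((\<alpha> * real N + \<beta> * real (N + 1)) / (\<phi> (cmod (varphi z)) * (1 - (cmod (varphi z))\<^sup>2) powr (1 + 1 / p)))
        * cnj (varphi z) * deriv varphi z)" if z: "z \<in> disk" for \<alpha> \<beta> z
  proof -
    have w: "varphi z \<in> disk" by (rule varphi_in_disk[OF z])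
    have ph: "0 < \<phi> (cmod (varphi z))" using w by (intro pos) auto
    have "test_function p \<phi> N \<alpha> \<beta> (varphi z) holomorphic_on disk"
      using test_function_hol_disk[OF w] by (simp add: hol_disk_def)
    from deriv_weighted_comp[OF this z] show ?thesis
      unfolding test_function_at_centre[where \<phi> = \<phi>, OF w ph] .
  qed
  have ph: "0 < \<phi> (cmod (varphi z))" if "z \<in> disk" for z
    using varphi_in_disk[OF that] by (intro pos) auto
  show ?i
  proof (rule tends_to_zero_at_boundary_mono[OF main[of "real (N + 1)" "- real N"], of 0 _ 1])
    fix z assume z: "z \<in> disk"
    show "\<bar>(1 - (cmod z)\<^sup>2) * cmod (deriv u z) / (\<phi> (cmod (varphi z)) * (1 - (cmod (varphi z))\<^sup>2) powr (1 / p))\<bar>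
      \<le> 1 * \<bar>(1 - (cmod z)\<^sup>2) * cmod (deriv (T (test_function p \<phi> N (real (N + 1)) (- real N) (varphi z))) z)\<bar>"
      unfolding val[OF z] using ph[OF z] by (simp add: norm_mult norm_divide abs_mult)
  qed auto
  \<comment> \<open>The derivative of the second kind of test function carries the factor \<open>cnj w\<close>, which is harmless for \<open>|w| > 1/2\<close>.\<close>
  show ?ii
  proof (rule tends_to_zero_at_boundary_mono[OF main[of "-1" 1], of "1 / 2" _ 2])
    fix z assume z: "z \<in> disk" and h: "1 / 2 < cmod (varphi z)"
    define X where "X = (1 - (cmod z)\<^sup>2) * cmod (u z * deriv varphi z) /
            (\<phi> (cmod (varphi z)) * (1 - (cmod (varphi z))\<^sup>2) powr (1 + 1 / p))"
    have X: "0 \<le> X" using disk_weight_nonneg[OF z] ph[OF z] by (simp add: X_def)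
    have "(1 - (cmod z)\<^sup>2) * cmod (deriv (T (test_function p \<phi> N (- 1) 1 (varphi z))) z) = X * cmod (varphi z)"
      unfolding val[OF z] using ph[OF z] by (simp add: X_def norm_mult norm_divide)
    moreover have "X \<le> 2 * (X * cmod (varphi z))"
      using mult_left_mono[OF less_imp_le[OF h] X] by simp
    ultimately show "\<bar>(1 - (cmod z)\<^sup>2) * cmod (u z * deriv varphi z) /
            (\<phi> (cmod (varphi z)) * (1 - (cmod (varphi z))\<^sup>2) powr (1 + 1 / p))\<bar>
        \<le> 2 * \<bar>(1 - (cmod z)\<^sup>2) * cmod (deriv (T (test_function p \<phi> N (- 1) 1 (varphi z))) z)\<bar>"
      using X unfolding X_def[symmetric] by simp
  qed auto
qed

end

section \<open>The boundary conditions imply compactness\<close>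

lemma deriv_small_of_small:
  assumes h: "h holomorphic_on disk" and \<delta>: "0 \<le> \<delta>" "\<delta> < 1"
    and small: "\<And>z. cmod z \<le> (1 + \<delta>) / 2 \<Longrightarrow> cmod (h z) \<le> \<eta>" and v: "cmod v \<le> \<delta>"
  shows "cmod (deriv h v) \<le> \<eta> * (2 / (1 - \<delta>))"
proof -
  have in_ball: "cmod x \<le> (1 + \<delta>) / 2" if "cmod (v - x) \<le> (1 - \<delta>) / 2" for x
    using norm_triangle_ineq4[of v "v - x"] that v by (simp add: field_simps)
  have sub: "cball v ((1 - \<delta>) / 2) \<subseteq> disk"
    using in_ball \<delta> by (fastforce simp: dist_norm)
  have "cmod ((deriv ^^ 1) h v) \<le> fact 1 * \<eta> / ((1 - \<delta>) / 2) ^ 1"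
  proof (rule Cauchy_inequality)
    show "h holomorphic_on ball v ((1 - \<delta>) / 2)"
      by (rule holomorphic_on_subset[OF h]) (use sub ball_subset_cball in blast)
    show "continuous_on (cball v ((1 - \<delta>) / 2)) h"
      by (rule continuous_on_subset[OF holomorphic_on_imp_continuous_on[OF h] sub])
    show "cmod (h x) \<le> \<eta>" if "cmod (v - x) = (1 - \<delta>) / 2" for x
      using that by (intro small in_ball) simp
  qed (use \<delta> in simp)
  then show ?thesis by simp
qed

context weighted_composition
begin

text \<open>
  The first bound is the Bloch seminorm of \<open>T 1 = u\<close> and the second follows by the
  product rule from it and the Bloch seminorm of \<open>T z = u varphi\<close>. The functions 1 and \<open>z\<close>
  belong to the domain by the bound for test functions with \<open>w = 0\<close>.
\<close>

lemma bounded_symbols: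
  assumes T: "T \<in> Hpp p \<phi> \<rightarrow> bloch"
  obtains L where "0 \<le> L" "\<And>z. z \<in> disk \<Longrightarrow> (1 - (cmod z)\<^sup>2) * cmod (deriv u z) \<le> L"
    "\<And>z. z \<in> disk \<Longrightarrow> (1 - (cmod z)\<^sup>2) * cmod (u z * deriv varphi z) \<le> L"
proof -
  obtain N where N: "2 \<le> real N * p" "1 + t * p < real N * p"
    by (rule exists_test_exponent[OF p_pos])
  have \<phi>0: "0 < \<phi> 0" by (intro pos) auto
  obtain M where M: "0 \<le> M"
    "\<And>w g. w \<in> disk \<Longrightarrow> g holomorphic_on disk \<Longrightarrow>
       (\<And>z. z \<in> disk \<Longrightarrow> cmod (g z) \<le> \<phi> 0 * (1 - (cmod w)\<^sup>2) powr (real N - 1 / p) / \<phi> (cmod w) / cmod (1 - cnj w * z) ^ N) \<Longrightarrow>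
       Hpp_integral p \<phi> g \<le> ennreal M"
    by (rule test_function_Hpp_bound[OF p_pos N less_imp_le[OF \<phi>0]]) blast
  have mem: "(\<lambda>z\<in>disk. g z) \<in> Hpp p \<phi>" if g: "g holomorphic_on disk" "\<And>z. z \<in> disk \<Longrightarrow> cmod (g z) \<le> 1" for g
  proof -
    have h: "(\<lambda>z\<in>disk. g z) holomorphic_on disk"
      by (rule holomorphic_transform[OF g(1)]) simp
    have "Hpp_integral p \<phi> (\<lambda>z\<in>disk. g z) \<le> ennreal M"
      by (rule M(2)[of 0]) (use h g \<phi>0 in auto)
    then show ?thesis
      using h by (intro Hpp_integral_bound_imp(1)[OF p_pos _ M(1)]) (auto simp: hol_disk_def)
  qed
  have bd: "(1 - (cmod z)\<^sup>2) * cmod (deriv u z * g (varphi z) + u z * (deriv g (varphi z) * deriv varphi z))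
      \<le> enn2real (bloch_seminorm (T (\<lambda>z\<in>disk. g z)))"
    if g: "g holomorphic_on disk" "\<And>z. z \<in> disk \<Longrightarrow> cmod (g z) \<le> 1" and z: "z \<in> disk" for g z
  proof -
    let ?g = "\<lambda>z\<in>disk. g z"
    have "?g \<in> Hpp p \<phi>" by (rule mem[OF g])
    then have "T ?g \<in> bloch" using T by blast
    then have fin: "bloch_seminorm (T ?g) < \<infinity>" by (simp add: bloch_def)
    have h: "?g holomorphic_on disk"
      by (rule holomorphic_transform[OF g(1)]) simp
    have eq: "T ?g = T g"
      using varphi_in_disk by (auto simp: weighted_comp_def fun_eq_iff restrict_def)
    show ?thesis
      using deriv_le_bloch_seminorm[OF fin z] unfolding eq deriv_weighted_comp[OF g(1) z] .
  qed
  define L1 where "L1 = enn2real (bloch_seminorm (T (\<lambda>z\<in>disk. 1)))"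
  define L2 where "L2 = enn2real (bloch_seminorm (T (\<lambda>z\<in>disk. z)))"
  have 1: "(1 - (cmod z)\<^sup>2) * cmod (deriv u z) \<le> L1" if "z \<in> disk" for z
    using bd[of "\<lambda>_. 1" z] that by (simp add: L1_def)
  have 2: "(1 - (cmod z)\<^sup>2) * cmod (deriv u z * varphi z + u z * deriv varphi z) \<le> L2" if "z \<in> disk" for z
    using bd[of "\<lambda>z. z" z] that by (simp add: L2_def)
  show thesis
  proof (rule that[of "L1 + L2"])
    have L: "0 \<le> L1" "0 \<le> L2" by (simp_all add: L1_def L2_def)
    then show "0 \<le> L1 + L2" by simp
    fix z :: complex assume z: "z \<in> disk"
    show "(1 - (cmod z)\<^sup>2) * cmod (deriv u z) \<le> L1 + L2"
      using 1[OF z] L by linarith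
    have "cmod (u z * deriv varphi z) \<le> cmod (deriv u z * varphi z + u z * deriv varphi z) + cmod (deriv u z * varphi z)"
      using norm_triangle_ineq4[of "deriv u z * varphi z + u z * deriv varphi z" "deriv u z * varphi z"] by simp
    also have "cmod (deriv u z * varphi z) \<le> cmod (deriv u z)"
      using varphi_in_disk[OF z] by (simp add: norm_mult mult_left_le)
    finally have "(1 - (cmod z)\<^sup>2) * cmod (u z * deriv varphi z)
        \<le> (1 - (cmod z)\<^sup>2) * (cmod (deriv u z * varphi z + u z * deriv varphi z) + cmod (deriv u z))"
      using disk_weight_nonneg[OF z] by (intro mult_left_mono) auto
    also have "\<dots> \<le> L1 + L2" using 1[OF z] 2[OF z] by (simp add: distrib_left)
    finally show "(1 - (cmod z)\<^sup>2) * cmod (u z * deriv varphi z) \<le> L1 + L2" .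
  qed
qed

text \<open>
  Where \<open>|varphi z| > \<delta>\<close>, the growth bounds of \<open>h n\<close> and its derivative are absorbed by the two conditions;
  where \<open>|varphi z| \<le> \<delta>\<close>, both \<open>h n\<close> and its derivative are uniformly small and the factors
  from the symbols are bounded.
\<close>

lemma eventually_deriv_small:
  assumes T: "T \<in> Hpp p \<phi> \<rightarrow> bloch"
    and i: "tends_to_zero_at_boundary varphi
      (\<lambda>z. (1 - (cmod z)\<^sup>2) * cmod (deriv u z) /
            (\<phi> (cmod (varphi z)) * (1 - (cmod (varphi z))\<^sup>2) powr (1 / p)))"
    and ii: "tends_to_zero_at_boundary varphi
      (\<lambda>z. (1 - (cmod z)\<^sup>2) * cmod (u z * deriv varphi z) /
            (\<phi> (cmod (varphi z)) * (1 - (cmod (varphi z))\<^sup>2) powr (1 + 1 / p)))"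
    and h: "\<And>n. h n holomorphic_on disk" "\<And>n. growth_bounded p \<phi> A (h n)"
    and lim: "\<And>K. compact K \<Longrightarrow> K \<subseteq> disk \<Longrightarrow> uniform_limit K h (\<lambda>_. 0) sequentially"
    and \<epsilon>: "0 < \<epsilon>"
  shows "\<forall>\<^sub>F n in sequentially. \<forall>z\<in>disk. (1 - (cmod z)\<^sup>2) *
    cmod (deriv u z * h n (varphi z) + u z * (deriv (h n) (varphi z) * deriv varphi z)) \<le> \<epsilon>"
proof -
  obtain L where L: "0 \<le> L" "\<And>z. z \<in> disk \<Longrightarrow> (1 - (cmod z)\<^sup>2) * cmod (deriv u z) \<le> L"
    "\<And>z. z \<in> disk \<Longrightarrow> (1 - (cmod z)\<^sup>2) * cmod (u z * deriv varphi z) \<le> L"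
    by (rule bounded_symbols[OF T]) blast
  obtain K where K: "0 < K"
    "\<And>f A z. f holomorphic_on disk \<Longrightarrow> growth_bounded p \<phi> A f \<Longrightarrow> z \<in> disk \<Longrightarrow>
       cmod (deriv f z) * (\<phi> (cmod z) * (1 - (cmod z)\<^sup>2) powr (1 + 1 / p)) \<le> K * A"
    by (rule deriv_growth_estimate[OF p_pos]) blast
  have A: "0 \<le> A" by (rule growth_bounded_nonneg[OF h(2)])
  have AK: "0 \<le> A + K * A" using A K by simp
  \<comment> \<open>\<open>A\<close> and \<open>K A\<close> bound the growth of \<open>h n\<close> and of its derivative; the 1 keeps the denominator positive.\<close>
  define \<epsilon>' where "\<epsilon>' = \<epsilon> / (A + K * A + 1)"
  have \<epsilon>': "0 < \<epsilon>'" using AK \<epsilon> by (simp add: \<epsilon>'_def)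
  have \<epsilon>'_le: "\<epsilon>' * A + \<epsilon>' * (K * A) \<le> \<epsilon>"
  proof -
    have "\<epsilon>' * A + \<epsilon>' * (K * A) \<le> \<epsilon>' * (A + K * A + 1)" using \<epsilon>' by (simp add: distrib_left)
    also have "\<dots> = \<epsilon>" using AK by (simp add: \<epsilon>'_def)
    finally show ?thesis .
  qed
  obtain \<delta>1 where \<delta>1: "\<delta>1 \<in> {0<..<1}" "\<And>z. z \<in> disk \<Longrightarrow> \<delta>1 < cmod (varphi z) \<Longrightarrow> cmod (varphi z) < 1 \<Longrightarrow>
      \<bar>(1 - (cmod z)\<^sup>2) * cmod (deriv u z) / (\<phi> (cmod (varphi z)) * (1 - (cmod (varphi z))\<^sup>2) powr (1 / p))\<bar> < \<epsilon>'"
    using i \<epsilon>' unfolding tends_to_zero_at_boundary_def by blast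
  obtain \<delta>2 where \<delta>2: "\<delta>2 \<in> {0<..<1}" "\<And>z. z \<in> disk \<Longrightarrow> \<delta>2 < cmod (varphi z) \<Longrightarrow> cmod (varphi z) < 1 \<Longrightarrow>
      \<bar>(1 - (cmod z)\<^sup>2) * cmod (u z * deriv varphi z) / (\<phi> (cmod (varphi z)) * (1 - (cmod (varphi z))\<^sup>2) powr (1 + 1 / p))\<bar> < \<epsilon>'"
    using ii \<epsilon>' unfolding tends_to_zero_at_boundary_def by blast
  define \<delta> where "\<delta> = max \<delta>1 \<delta>2"
  have \<delta>: "0 \<le> \<delta>" "\<delta> < 1" using \<delta>1(1) \<delta>2(1) by (auto simp: \<delta>_def)
  define R where "R = 1 + 2 / (1 - \<delta>)"
  have LR: "0 \<le> L * R" using L(1) \<delta> by (simp add: R_def)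
  define \<eta> where "\<eta> = \<epsilon> / (L * R + 1)"
  have \<eta>: "0 < \<eta>" using LR \<epsilon> by (simp add: \<eta>_def)
  have \<eta>_le: "L * \<eta> + L * (\<eta> * (2 / (1 - \<delta>))) \<le> \<epsilon>"
  proof -
    have "L * \<eta> + L * (\<eta> * (2 / (1 - \<delta>))) = \<eta> * (L * R)" by (simp add: R_def algebra_simps)
    also have "\<dots> \<le> \<eta> * (L * R + 1)" using \<eta> by (intro mult_left_mono) auto
    also have "\<dots> = \<epsilon>" using LR by (simp add: \<eta>_def)
    finally show ?thesis .
  qed
  have "uniform_limit (cball 0 ((1 + \<delta>) / 2)) h (\<lambda>_. 0) sequentially"
    using \<delta> by (intro lim) auto
  then have "\<forall>\<^sub>F n in sequentially. \<forall>z\<in>cball 0 ((1 + \<delta>) / 2). cmod (h n z) < \<eta>"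
    using \<eta> by (simp add: uniform_limit_iff)
  then show ?thesis
  proof eventually_elim
    case (elim n)
    show ?case
    proof
      fix z :: complex assume z: "z \<in> disk"
      define v where "v = varphi z"
      define q where "q = 1 - (cmod z)\<^sup>2"
      have q: "0 \<le> q" unfolding q_def by (rule disk_weight_nonneg[OF z])
      have v: "v \<in> disk" unfolding v_def by (rule varphi_in_disk[OF z])
      have "q * cmod (deriv u z * h n v + u z * (deriv (h n) v * deriv varphi z))
          \<le> q * (cmod (deriv u z * h n v) + cmod (u z * (deriv (h n) v * deriv varphi z)))"
        using q by (intro mult_left_mono norm_triangle_ineq)
      also have "\<dots> = (q * cmod (deriv u z)) * cmod (h n v) + (q * cmod (u z * deriv varphi z)) * cmod (deriv (h n) v)"
        by (simp add: norm_mult distrib_left mult_ac)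
      also have "\<dots> \<le> \<epsilon>"
      proof (cases "cmod v \<le> \<delta>")
        case True
        have "cmod (h n v) \<le> \<eta>" using elim True \<delta> by (intro less_imp_le) auto
        moreover have "cmod (deriv (h n) v) \<le> \<eta> * (2 / (1 - \<delta>))"
          using elim by (intro deriv_small_of_small[OF h(1) \<delta> _ True] less_imp_le) auto
        ultimately have "(q * cmod (deriv u z)) * cmod (h n v) + (q * cmod (u z * deriv varphi z)) * cmod (deriv (h n) v)
            \<le> L * \<eta> + L * (\<eta> * (2 / (1 - \<delta>)))"
          using L(2,3)[OF z] L(1) unfolding q_def by (intro add_mono mult_mono) auto
        with \<eta>_le show ?thesis by linarith
      next
        case False
        define V1 where "V1 = \<phi> (cmod v) * (1 - (cmod v)\<^sup>2) powr (1 / p)"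
        define V2 where "V2 = \<phi> (cmod v) * (1 - (cmod v)\<^sup>2) powr (1 + 1 / p)"
        have "0 < 1 - (cmod v)\<^sup>2" using v by (simp add: power_less_one_iff abs_square_less_1)
        moreover have "0 < \<phi> (cmod v)" using v by (intro pos) auto
        ultimately have V: "0 < V1" "0 < V2" by (simp_all add: V1_def V2_def)
        have v1: "\<delta>1 < cmod (varphi z)" "\<delta>2 < cmod (varphi z)" "cmod (varphi z) < 1"
          using False v by (auto simp: \<delta>_def v_def)
        have "q * cmod (deriv u z) / V1 < \<epsilon>'"
          using \<delta>1(2)[OF z v1(1,3)] unfolding q_def V1_def v_def by linarith
        then have 1: "q * cmod (deriv u z) \<le> \<epsilon>' * V1" using V by (simp add: divide_less_eq)
        have "q * cmod (u z * deriv varphi z) / V2 < \<epsilon>'"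
          using \<delta>2(2)[OF z v1(2,3)] unfolding q_def V2_def v_def by linarith
        then have 2: "q * cmod (u z * deriv varphi z) \<le> \<epsilon>' * V2" using V by (simp add: divide_less_eq)
        have "(q * cmod (deriv u z)) * cmod (h n v) \<le> \<epsilon>' * V1 * cmod (h n v)"
          using 1 by (intro mult_right_mono) auto
        also have "\<dots> = \<epsilon>' * (cmod (h n v) * V1)" by simp
        also have "\<dots> \<le> \<epsilon>' * A"
          using h(2)[of n] v \<epsilon>' by (intro mult_left_mono) (auto simp: growth_bounded_def V1_def)
        finally have 3: "(q * cmod (deriv u z)) * cmod (h n v) \<le> \<epsilon>' * A" .
        have "(q * cmod (u z * deriv varphi z)) * cmod (deriv (h n) v) \<le> \<epsilon>' * V2 * cmod (deriv (h n) v)"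
          using 2 by (intro mult_right_mono) auto
        also have "\<dots> = \<epsilon>' * (cmod (deriv (h n) v) * V2)" by simp
        also have "\<dots> \<le> \<epsilon>' * (K * A)"
          using K(2)[OF h v, of n] \<epsilon>' by (intro mult_left_mono) (auto simp: V2_def)
        finally show ?thesis using 3 \<epsilon>'_le by linarith
      qed
      finally show "(1 - (cmod z)\<^sup>2) *
          cmod (deriv u z * h n (varphi z) + u z * (deriv (h n) (varphi z) * deriv varphi z)) \<le> \<epsilon>"
        by (simp add: q_def v_def)
    qed
  qed
qed

text \<open>
  The limit \<open>g\<close> from Montel's theorem inherits the growth bound of the sequence, so the differences
  \<open>f (r n) - g\<close> have a common growth bound and \<open>eventually_deriv_small\<close> applies to them.
\<close>

lemma boundary_conditions_imp_subsequence:
  assumes T: "T \<in> Hpp p \<phi> \<rightarrow> bloch"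
    and i: "tends_to_zero_at_boundary varphi
      (\<lambda>z. (1 - (cmod z)\<^sup>2) * cmod (deriv u z) /
            (\<phi> (cmod (varphi z)) * (1 - (cmod (varphi z))\<^sup>2) powr (1 / p)))"
    and ii: "tends_to_zero_at_boundary varphi
      (\<lambda>z. (1 - (cmod z)\<^sup>2) * cmod (u z * deriv varphi z) /
            (\<phi> (cmod (varphi z)) * (1 - (cmod (varphi z))\<^sup>2) powr (1 + 1 / p)))"
    and f: "\<And>n. f n \<in> Hpp p \<phi>" "\<And>n. Hpp_norm p \<phi> (f n) \<le> M"
  shows "\<exists>l\<in>bloch. \<exists>r. strict_mono (r :: nat \<Rightarrow> nat) \<and> (\<lambda>n. bloch_dist (T (f (r n))) l) \<longlonglongrightarrow> 0"
proof -
  obtain A where A: "\<And>n. growth_bounded p \<phi> A (f n)"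
    using growth_estimate[OF p_pos] f by metis
  have hol: "f n holomorphic_on disk" for n using f(1)[of n] by (simp add: Hpp_def hol_disk_def)
  obtain g r where g: "g holomorphic_on disk" and r: "strict_mono (r :: nat \<Rightarrow> nat)"
    and ptw: "\<And>x. x \<in> disk \<Longrightarrow> (\<lambda>n. f (r n) x) \<longlonglongrightarrow> g x"
    and unif: "\<And>K. compact K \<Longrightarrow> K \<subseteq> disk \<Longrightarrow> uniform_limit K (f \<circ> r) g sequentially"
  proof (rule Montel[where S = disk and \<H> = "{h. h holomorphic_on disk \<and> growth_bounded p \<phi> A h}" and \<F> = f])
    show "range f \<subseteq> {h. h holomorphic_on disk \<and> growth_bounded p \<phi> A h}" using hol A by auto
    show "\<exists>B. \<forall>h\<in>{h. h holomorphic_on disk \<and> growth_bounded p \<phi> A h}. \<forall>z\<in>K. cmod (h z) \<le> B"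
      if "compact K" "K \<subseteq> disk" for K
      by (rule growth_bounded_locally_bounded[OF p_pos that])
  qed (blast | simp)+
  have gA: "growth_bounded p \<phi> A g"
    unfolding growth_bounded_def
  proof
    fix z :: complex assume z: "z \<in> disk"
    have "(\<lambda>n. cmod (f (r n) z) * (\<phi> (cmod z) * (1 - (cmod z)\<^sup>2) powr (1 / p)))
        \<longlonglongrightarrow> cmod (g z) * (\<phi> (cmod z) * (1 - (cmod z)\<^sup>2) powr (1 / p))"
      by (intro tendsto_intros ptw z)
    then show "cmod (g z) * (\<phi> (cmod z) * (1 - (cmod z)\<^sup>2) powr (1 / p)) \<le> A"
      by (rule LIMSEQ_le_const2) (use A z in \<open>auto simp: growth_bounded_def\<close>)
  qed
  define h where "h = (\<lambda>n z. f (r n) z - g z)"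
  have hh: "h n holomorphic_on disk" for n unfolding h_def by (intro holomorphic_intros hol g)
  have hA: "growth_bounded p \<phi> (A + A) (h n)" for n
    unfolding h_def by (intro growth_bounded_diff A gA)
  have hl: "uniform_limit K h (\<lambda>_. 0) sequentially" if "compact K" "K \<subseteq> disk" for K
    using unif[OF that] by (simp add: uniform_limit_iff h_def dist_norm)
  have dT: "deriv (T (f (r n))) z - deriv (T g) z
      = deriv u z * h n (varphi z) + u z * (deriv (h n) (varphi z) * deriv varphi z)" if z: "z \<in> disk" for n z
  proof -
    have hv: "h n (varphi z) = f (r n) (varphi z) - g (varphi z)" by (simp add: h_def)
    have dh: "deriv (h n) (varphi z) = deriv (f (r n)) (varphi z) - deriv g (varphi z)"
      unfolding h_def by (rule deriv_diff_disk[OF hol g varphi_in_disk[OF z]])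
    show ?thesis
      unfolding deriv_weighted_comp[OF hol z] deriv_weighted_comp[OF g z] hv dh by (simp add: algebra_simps)
  qed
  have close: "\<forall>\<^sub>F n in sequentially. \<forall>z\<in>disk. (1 - (cmod z)\<^sup>2) * cmod (deriv (T (f (r n))) z - deriv (T g) z) \<le> \<epsilon>"
    if "0 < \<epsilon>" for \<epsilon>
    using eventually_deriv_small[OF T i ii, of h "A + A" \<epsilon>] hh hA hl that by (simp add: dT)
  have Tf: "T (f n) \<in> bloch" for n using T f by blast
  have Tg: "T g \<in> bloch"
  proof -
    obtain n where "\<forall>z\<in>disk. (1 - (cmod z)\<^sup>2) * cmod (deriv (T (f (r n))) z - deriv (T g) z) \<le> 1"
      using eventually_happens'[OF sequentially_bot close[of 1]] by auto
    then show ?thesis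
      by (intro in_bloch_of_deriv_close[OF Tf weighted_comp_hol_disk[OF g]]) blast
  qed
  have "(\<lambda>n. bloch_dist (T (f (r n))) (T g)) \<longlonglongrightarrow> 0"
  proof (rule tendstoI)
    fix e :: real assume e: "0 < e"
    have 0: "(0::complex) \<in> disk" by simp
    have "(\<lambda>n. u 0 * f (r n) (varphi 0)) \<longlonglongrightarrow> u 0 * g (varphi 0)"
      by (intro tendsto_intros ptw varphi_in_disk 0)
    then have "\<forall>\<^sub>F n in sequentially. cmod (u 0 * f (r n) (varphi 0) - u 0 * g (varphi 0)) < e / 2"
      using e unfolding tendsto_iff dist_norm by (meson half_gt_zero)
    moreover have "\<forall>\<^sub>F n in sequentially. \<forall>z\<in>disk. (1 - (cmod z)\<^sup>2) * cmod (deriv (T (f (r n))) z - deriv (T g) z) \<le> e / 2"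
      using e by (intro close) simp
    ultimately show "\<forall>\<^sub>F n in sequentially. dist (bloch_dist (T (f (r n))) (T g)) 0 < e"
    proof eventually_elim
      case (elim n)
      have "bloch_dist (T (f (r n))) (T g) \<le> cmod (T (f (r n)) 0 - T g 0) + e / 2"
        using elim(2) e weighted_comp_hol_disk[OF hol] weighted_comp_hol_disk[OF g]
        by (intro bloch_dist_le) (auto simp: hol_disk_def)
      also have "T (f (r n)) 0 - T g 0 = u 0 * f (r n) (varphi 0) - u 0 * g (varphi 0)"
        by (simp add: weighted_comp_def)
      finally have "bloch_dist (T (f (r n))) (T g) < e" using elim(1) by linarith
      moreover have "0 \<le> bloch_dist (T (f (r n))) (T g)"
        by (rule Metric_space.nonneg[OF Metric_space_bloch])
      ultimately show ?case by simp
    qed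
  qed
  with Tg r show ?thesis by blast
qed

lemma boundary_conditions_imp_compact:
  assumes T: "T \<in> Hpp p \<phi> \<rightarrow> bloch"
    and i: "tends_to_zero_at_boundary varphi
      (\<lambda>z. (1 - (cmod z)\<^sup>2) * cmod (deriv u z) /
            (\<phi> (cmod (varphi z)) * (1 - (cmod (varphi z))\<^sup>2) powr (1 / p)))"
    and ii: "tends_to_zero_at_boundary varphi
      (\<lambda>z. (1 - (cmod z)\<^sup>2) * cmod (u z * deriv varphi z) /
            (\<phi> (cmod (varphi z)) * (1 - (cmod (varphi z))\<^sup>2) powr (1 + 1 / p)))"
  shows "compact_operator (Hpp p \<phi>) (Hpp_norm p \<phi>) bloch_topology T"
  unfolding compact_operator_def topspace_bloch_topology
proof (intro conjI allI impI T)
  fix S assume S: "S \<subseteq> Hpp p \<phi>" "norm_bounded (Hpp_norm p \<phi>) S"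
  then obtain M where M: "\<And>f. f \<in> S \<Longrightarrow> Hpp_norm p \<phi> f \<le> M" by (auto simp: norm_bounded_def)
  show "compactin bloch_topology (bloch_topology closure_of (T ` S))"
  proof (rule compactin_bloch_closure_of)
    show "T ` S \<subseteq> bloch" using T S by blast
    fix \<sigma> :: "nat \<Rightarrow> complex \<Rightarrow> complex" assume "range \<sigma> \<subseteq> T ` S"
    then have "\<forall>n. \<exists>f\<in>S. \<sigma> n = T f" by blast
    then obtain f where f: "\<And>n. f n \<in> S" "\<And>n. \<sigma> n = T (f n)" by metis
    show "\<exists>l\<in>bloch. \<exists>r. strict_mono (r :: nat \<Rightarrow> nat) \<and> (\<lambda>n. bloch_dist (\<sigma> (r n)) l) \<longlonglongrightarrow> 0"
      unfolding f(2) using f(1) S(1) M by (intro boundary_conditions_imp_subsequence[OF T i ii]) blast+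
  qed
qed

end

theorem theorem3p2:
  fixes varphi u :: "complex \<Rightarrow> complex" and p :: real and \<phi> :: "real \<Rightarrow> real"
  assumes "varphi holomorphic_on disk"
    and "varphi ` disk \<subseteq> disk"
    and "u holomorphic_on disk"
    and "0 < p"
    and "normal_weight \<phi>"
    and "bounded_operator (Hpp p \<phi>) (Hpp_norm p \<phi>) bloch bloch_norm (weighted_comp u varphi)"
  shows "compact_operator (Hpp p \<phi>) (Hpp_norm p \<phi>) bloch_topology (weighted_comp u varphi) \<longleftrightarrow>
    tends_to_zero_at_boundary varphi
      (\<lambda>z. (1 - (cmod z)\<^sup>2) * cmod (deriv u z) /
            (\<phi> (cmod (varphi z)) * (1 - (cmod (varphi z))\<^sup>2) powr (1 / p))) \<and>
    tends_to_zero_at_boundary varphi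
      (\<lambda>z. (1 - (cmod z)\<^sup>2) * cmod (u z * deriv varphi z) /
            (\<phi> (cmod (varphi z)) * (1 - (cmod (varphi z))\<^sup>2) powr (1 + 1 / p)))"
proof -
  obtain s t C where gw: "growth_weight \<phi> s t C"
    by (rule normal_weight_imp_growth_weight[OF assms(5)])
  interpret growth_weight \<phi> s t C by (rule gw)
  interpret weighted_composition \<phi> s t C p u varphi
    by unfold_locales (use assms in auto)
  have T: "weighted_comp u varphi \<in> Hpp p \<phi> \<rightarrow> bloch"
    using assms(6) by (simp add: bounded_operator_def)
  show ?thesis
    using compact_imp_boundary_conditions boundary_conditions_imp_compact[OF T] by blast
qed

end
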